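(* Let $f:\Sigma\to\mathbb{R}^3$ be a front, $p\in\Sigma$ a cuspidal edge and $\gamma$ the singular curve of $f$ passing through $p$. The Gaussian curvature $K_{\widehat{FC}_f}$ and the mean curvature $H_{\widehat{FC}_f}$ of the focal surface $\widehat{FC}_f$ are given along $\gamma$ (near $p$) by $$K_{\widehat{FC}_f}=-\frac14\left(4\kappa_t^2+\kappa_s\kappa_c^2\right),\qquad H_{\widehat{FC}_f}=\pm\frac18\left(\kappa_c^2-4\kappa_s\right),$$ where the sign $\pm$ of $H_{\widehat{FC}_f}$ depends on the orientation of the unit normal vector to $\widehat{FC}_f$.
   Context: Let $\Sigma\subset\mathbb{R}^2$ be a domain. A $C^\infty$ map $f:\Sigma\to\mathbb{R}^3$ is a (wave) front if there is a $C^\infty$ unit vector field $\nu:\Sigma\to S^2$ (the unit normal) with $\langle df_q(X),\nu(q)\rangle=0$ for all $q\in\Sigma$, $X\in T_q\Sigma$, such that $(f,\nu):\Sigma\to\mathbb{R}^3\times S^2$ is an immersion. $S(f)$ denotes the set of points where $f$ is not an immersion. A point $p$ is a cuspidal edge of $f$ if the germ of $f$ at $p$ coincides, up to diffeomorphism germs of source and target, with the germ of $(u,v)\mapsto(u,v^2,v^3)$ at $0$. Adapted coordinates. Near a cuspidal edge $p$, $S(f)$ is a regular curve consisting of cuspidal edges, and there is a coordinate system $(U;u,v)$ centered at $p$ with $S(f)\cap U=\{v=0\}$, $f_v(u,0)=0$ and $\lambda_v(u,0)>0$, where $\lambda=\det(f_u,f_v,\nu)$. The singular curve is $\gamma(u)=(u,0)$.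 Write $f_v=vh$ with $h:U\to\mathbb{R}^3\setminus\{0\}$ smooth, and set $\tilde E=|f_u|^2$, $\tilde F=\langle f_u,h\rangle$, $\tilde G=|h|^2$, $\tilde L=-\langle f_u,\nu_u\rangle$, $\tilde M=-\langle h,\nu_u\rangle$, $\tilde N=-\langle h,\nu_v\rangle$, $\tilde A=\tilde E\tilde N-2v\tilde F\tilde M+v\tilde G\tilde L$, $\tilde B=\sqrt{\tilde A^2-4v(\tilde E\tilde G-\tilde F^2)(\tilde L\tilde N-v\tilde M^2)}$. Here $\tilde N\neq0$ on the $u$-axis; let $\epsilon=\mathrm{sgn}\,\tilde N(p)$. After shrinking $U$, the two principal curvatures of $f$ at points with $v\ne0$ are the bounded one $\kappa=\frac{2(\tilde L\tilde N-v\tilde M^2)}{\tilde A+\epsilon\tilde B}$, which is $C^\infty$ on $U$, and the unbounded one $\kappa'=\frac{\tilde A+\epsilon\tilde B}{2v(\tilde E\tilde G-\tilde F^2)}$. Set $\hat\kappa=\lambda\kappa'$, which extends to a $C^\infty$ function $\hat\kappa=\frac{\tilde A+\epsilon\tilde B}{2|f_u\times h|}$ on $U$, nowhere zero near the $u$-axis. The focal surface corresponding to the unbounded principal curvature is $\widehat{FC}_f=f+\frac{\lambda}{\hat\kappa}\nu$, which is an immersion near $p$, so its Gaussian and mean curvatures are defined. Invariants of cuspidal edges (along the $u$-axis, in an adapted coordinate system): the singular curvature $\kappa_s$, the cuspidal curvature $\kappa_c$ and the cusp-directional torsion $\kappa_t$ are $$\kappa_s=\mathrm{sgn}(\lambda_v)\frac{\det(f_u,f_{uu},\nu)}{|f_u|^3},\quad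 \kappa_c=\frac{|f_u|^{3/2}\det(f_u,f_{vv},f_{vvv})}{|f_u\times f_{vv}|^{5/2}},$$ $$\kappa_t=\frac{\det(f_u,f_{vv},f_{uvv})}{|f_u\times f_{vv}|^2}-\frac{\det(f_u,f_{vv},f_{uu})\langle f_u,f_{vv}\rangle}{|f_u|^2|f_u\times f_{vv}|^2}.$$ *)

theory Defs
  imports "HOL-Analysis.Analysis"
begin

section \<open>Smooth maps, immersions and fronts\<close>

text \<open>The notions below are used on open sets only, so that derivatives are taken with
  respect to full neighbourhoods.\<close>

fun times_differentiable_on ::
  "nat \<Rightarrow> 'a::real_normed_vector set \<Rightarrow> ('a \<Rightarrow> 'b::real_normed_vector) \<Rightarrow> bool" where
  "times_differentiable_on 0 S f \<longleftrightarrow> continuous_on S f"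
| "times_differentiable_on (Suc n) S f \<longleftrightarrow>
     (\<forall>x\<in>S. f differentiable (at x)) \<and>
     (\<forall>X. times_differentiable_on n S (\<lambda>x. frechet_derivative f (at x) X))"

definition smooth_on :: "'a::real_normed_vector set \<Rightarrow> ('a \<Rightarrow> 'b::real_normed_vector) \<Rightarrow> bool" where
  "smooth_on S f \<longleftrightarrow> (\<forall>n. times_differentiable_on n S f)"

definition diffeomorphism ::
  "'a::real_normed_vector set \<Rightarrow> 'b::real_normed_vector set \<Rightarrow> ('a \<Rightarrow> 'b) \<Rightarrow> ('b \<Rightarrow> 'a) \<Rightarrow> bool" where
  "diffeomorphism U V \<phi> \<psi> \<longleftrightarrow>
     open U \<and> open V \<and> homeomorphism U V \<phi> \<psi> \<and> smooth_on U \<phi> \<and> smooth_on V \<psi>"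

definition immersion_on :: "'a::real_normed_vector set \<Rightarrow> ('a \<Rightarrow> 'b::real_normed_vector) \<Rightarrow> bool" where
  "immersion_on S f \<longleftrightarrow> smooth_on S f \<and> (\<forall>x\<in>S. inj (frechet_derivative f (at x)))"

definition unit_normal_on :: "(real^2) set \<Rightarrow> (real^2 \<Rightarrow> real^3) \<Rightarrow> (real^2 \<Rightarrow> real^3) \<Rightarrow> bool" where
  "unit_normal_on S f \<nu> \<longleftrightarrow> smooth_on S \<nu> \<and>
     (\<forall>q\<in>S. norm (\<nu> q) = 1 \<and> (\<forall>X. frechet_derivative f (at q) X \<bullet> \<nu> q = 0))"

definition front_with_normal :: "(real^2) set \<Rightarrow> (real^2 \<Rightarrow> real^3) \<Rightarrow> (real^2 \<Rightarrow> real^3) \<Rightarrow> bool" where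
  "front_with_normal \<Sigma> f \<nu> \<longleftrightarrow>
     smooth_on \<Sigma> f \<and> unit_normal_on \<Sigma> f \<nu> \<and> immersion_on \<Sigma> (\<lambda>q. (f q, \<nu> q))"

definition singular_set :: "(real^2) set \<Rightarrow> (real^2 \<Rightarrow> real^3) \<Rightarrow> (real^2) set" where
  "singular_set \<Sigma> f = {q\<in>\<Sigma>. \<not> inj (frechet_derivative f (at q))}"

definition cuspidal_edge :: "(real^2) set \<Rightarrow> (real^2 \<Rightarrow> real^3) \<Rightarrow> real^2 \<Rightarrow> bool" where
  "cuspidal_edge \<Sigma> f p \<longleftrightarrow>
     (\<exists>U V \<phi> \<phi>' (X :: (real^3) set) (Y :: (real^3) set) \<Phi> \<Phi>'.
        diffeomorphism (U :: (real^2) set) V \<phi> \<phi>' \<and> 0 \<in> U \<and> V \<subseteq> \<Sigma> \<and> \<phi> 0 = p \<and>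
        diffeomorphism X Y \<Phi> \<Phi>' \<and> f ` V \<subseteq> X \<and> \<Phi> (f p) = 0 \<and>
        (\<forall>x\<in>U. \<Phi> (f (\<phi> x)) = (vector [x$1, (x$2)^2, (x$2)^3] :: real^3)))"

section \<open>Adapted coordinates\<close>

text \<open>A point of the coordinate domain is \<open>x = (u, v)\<close> with \<open>u = x$1\<close> and \<open>v = x$2\<close>.\<close>

definition pdu :: "(real^2 \<Rightarrow> 'b::real_normed_vector) \<Rightarrow> real^2 \<Rightarrow> 'b" where
  "pdu f x = frechet_derivative f (at x) (axis 1 1)"

definition pdv :: "(real^2 \<Rightarrow> 'b::real_normed_vector) \<Rightarrow> real^2 \<Rightarrow> 'b" where
  "pdv f x = frechet_derivative f (at x) (axis 2 1)"

definition det3 :: "real^3 \<Rightarrow> real^3 \<Rightarrow> real^3 \<Rightarrow> real" where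
  "det3 a b c = det (vector [a, b, c] :: real^3^3)"

definition area_density :: "(real^2 \<Rightarrow> real^3) \<Rightarrow> (real^2 \<Rightarrow> real^3) \<Rightarrow> real^2 \<Rightarrow> real" where
  "area_density f \<nu> x = det3 (pdu f x) (pdv f x) (\<nu> x)"

text \<open>\<open>\<phi>\<close> is the parametrization of a coordinate neighbourhood of \<open>p\<close> in \<open>\<Sigma>\<close> by
  the open set \<open>U\<close> of coordinate values, so \<open>f \<circ> \<phi>\<close> is \<open>f\<close> written in the coordinates.\<close>

definition adapted_coordinates ::
  "(real^2) set \<Rightarrow> (real^2 \<Rightarrow> real^3) \<Rightarrow> (real^2 \<Rightarrow> real^3) \<Rightarrow> real^2 \<Rightarrow> (real^2) set \<Rightarrow> (real^2 \<Rightarrow> real^2) \<Rightarrow> bool" where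
  "adapted_coordinates \<Sigma> f \<nu> p U \<phi> \<longleftrightarrow>
     (\<exists>V \<psi>. diffeomorphism U V \<phi> \<psi> \<and> V \<subseteq> \<Sigma>) \<and> 0 \<in> U \<and> \<phi> 0 = p \<and>
     (\<forall>x\<in>U. \<phi> x \<in> singular_set \<Sigma> f \<longleftrightarrow> x$2 = 0) \<and>
     (\<forall>x\<in>U. x$2 = 0 \<longrightarrow> pdv (f \<circ> \<phi>) x = 0 \<and> pdv (area_density (f \<circ> \<phi>) (\<nu> \<circ> \<phi>)) x > 0)"

text \<open>The factor \<open>h\<close> in \<open>f_v = v h\<close>; it is uniquely determined by \<open>f\<close> on \<open>U\<close>.\<close>

definition singular_factor ::
  "(real^2) set \<Rightarrow> (real^2 \<Rightarrow> real^3) \<Rightarrow> (real^2 \<Rightarrow> real^3) \<Rightarrow> bool" where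
  "singular_factor U f h \<longleftrightarrow>
     smooth_on U h \<and> (\<forall>x\<in>U. h x \<noteq> 0 \<and> pdv f x = x$2 *\<^sub>R h x)"

section \<open>Unbounded principal curvature and its focal surface\<close>

definition tE :: "(real^2 \<Rightarrow> real^3) \<Rightarrow> real^2 \<Rightarrow> real" where
  "tE f x = (norm (pdu f x))\<^sup>2"

definition tF :: "(real^2 \<Rightarrow> real^3) \<Rightarrow> (real^2 \<Rightarrow> real^3) \<Rightarrow> real^2 \<Rightarrow> real" where
  "tF f h x = pdu f x \<bullet> h x"

definition tG :: "(real^2 \<Rightarrow> real^3) \<Rightarrow> real^2 \<Rightarrow> real" where
  "tG h x = (norm (h x))\<^sup>2"

definition tL :: "(real^2 \<Rightarrow> real^3) \<Rightarrow> (real^2 \<Rightarrow> real^3) \<Rightarrow> real^2 \<Rightarrow> real" where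
  "tL f \<nu> x = - (pdu f x \<bullet> pdu \<nu> x)"

definition tM :: "(real^2 \<Rightarrow> real^3) \<Rightarrow> (real^2 \<Rightarrow> real^3) \<Rightarrow> real^2 \<Rightarrow> real" where
  "tM h \<nu> x = - (h x \<bullet> pdu \<nu> x)"

definition tN :: "(real^2 \<Rightarrow> real^3) \<Rightarrow> (real^2 \<Rightarrow> real^3) \<Rightarrow> real^2 \<Rightarrow> real" where
  "tN h \<nu> x = - (h x \<bullet> pdv \<nu> x)"

definition tA :: "(real^2 \<Rightarrow> real^3) \<Rightarrow> (real^2 \<Rightarrow> real^3) \<Rightarrow> (real^2 \<Rightarrow> real^3) \<Rightarrow> real^2 \<Rightarrow> real" where
  "tA f \<nu> h x = tE f x * tN h \<nu> x - 2 * x$2 * tF f h x * tM h \<nu> x + x$2 * tG h x * tL f \<nu> x"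

definition tB :: "(real^2 \<Rightarrow> real^3) \<Rightarrow> (real^2 \<Rightarrow> real^3) \<Rightarrow> (real^2 \<Rightarrow> real^3) \<Rightarrow> real^2 \<Rightarrow> real" where
  "tB f \<nu> h x = sqrt ((tA f \<nu> h x)\<^sup>2 -
     4 * x$2 * (tE f x * tG h x - (tF f h x)\<^sup>2) * (tL f \<nu> x * tN h \<nu> x - x$2 * (tM h \<nu> x)\<^sup>2))"

text \<open>The numerator common to both curvatures below; the coordinates are centered at the
  cuspidal edge, which is therefore the point \<open>0\<close> at which the sign is taken.\<close>

definition tAB :: "(real^2 \<Rightarrow> real^3) \<Rightarrow> (real^2 \<Rightarrow> real^3) \<Rightarrow> (real^2 \<Rightarrow> real^3) \<Rightarrow> real^2 \<Rightarrow> real" where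
  "tAB f \<nu> h x = tA f \<nu> h x + sgn (tN h \<nu> 0) * tB f \<nu> h x"

definition unbounded_curvature ::
  "(real^2 \<Rightarrow> real^3) \<Rightarrow> (real^2 \<Rightarrow> real^3) \<Rightarrow> (real^2 \<Rightarrow> real^3) \<Rightarrow> real^2 \<Rightarrow> real" where
  "unbounded_curvature f \<nu> h x = tAB f \<nu> h x / (2 * x$2 * (tE f x * tG h x - (tF f h x)\<^sup>2))"

definition hat_curvature ::
  "(real^2 \<Rightarrow> real^3) \<Rightarrow> (real^2 \<Rightarrow> real^3) \<Rightarrow> (real^2 \<Rightarrow> real^3) \<Rightarrow> real^2 \<Rightarrow> real" where
  "hat_curvature f \<nu> h x = tAB f \<nu> h x / (2 * norm (cross3 (pdu f x) (h x)))"

lemma hat_curvature_eq: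
  assumes v: "x$2 \<noteq> 0" and f_v: "pdv f x = x$2 *\<^sub>R h x"
    and \<nu>: "norm (\<nu> x) = 1" "pdu f x \<bullet> \<nu> x = 0" "pdv f x \<bullet> \<nu> x = 0"
    and pos: "area_density f \<nu> x / x$2 > 0"
  shows "hat_curvature f \<nu> h x = area_density f \<nu> x * unbounded_curvature f \<nu> h x"
proof -
  let ?w = "cross3 (pdu f x) (h x)"
  have h\<nu>: "h x \<bullet> \<nu> x = 0"
    using v \<nu>(3) by (simp add: f_v)
  have area: "area_density f \<nu> x = x$2 * (?w \<bullet> \<nu> x)"
    unfolding area_density_def det3_def dot_cross_det[symmetric] f_v
    by (simp add: cross3_simps)
  have "cross3 (\<nu> x) ?w = (\<nu> x \<bullet> h x) *\<^sub>R pdu f x - (\<nu> x \<bullet> pdu f x) *\<^sub>R h x"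
    by (simp add: Lagrange)
  then have "cross3 ?w (\<nu> x) = 0"
    using h\<nu> \<nu>(2) by (metis cross_skew inner_commute scaleR_zero_left diff_zero neg_equal_0_iff_equal)
  then have sq: "(?w \<bullet> \<nu> x)\<^sup>2 = (norm ?w)\<^sup>2"
    using norm_cross_dot[of ?w "\<nu> x"] \<nu>(1) by simp
  have w\<nu>: "?w \<bullet> \<nu> x > 0"
    using pos v by (simp add: area)
  with sq have nw: "norm ?w = ?w \<bullet> \<nu> x"
    by (metis less_eq_real_def norm_ge_zero power2_eq_iff_nonneg)
  have "tE f x * tG h x - (tF f h x)\<^sup>2 = (norm ?w)\<^sup>2"
    using norm_cross_dot[of "pdu f x" "h x"]
    by (simp add: tE_def tF_def tG_def power_mult_distrib)
  then show ?thesis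
    using v w\<nu>
    by (simp add: hat_curvature_def unbounded_curvature_def area nw power2_eq_square)
qed

definition focal_surface ::
  "(real^2 \<Rightarrow> real^3) \<Rightarrow> (real^2 \<Rightarrow> real^3) \<Rightarrow> (real^2 \<Rightarrow> real^3) \<Rightarrow> real^2 \<Rightarrow> real^3" where
  "focal_surface f \<nu> h x = f x + (area_density f \<nu> x / hat_curvature f \<nu> h x) *\<^sub>R \<nu> x"

section \<open>Curvatures of an immersed surface\<close>

text \<open>Here \<open>n\<close> is a unit normal of \<open>g\<close>; replacing it by its negative changes the sign of the
  mean curvature.\<close>

definition gauss_curvature :: "(real^2 \<Rightarrow> real^3) \<Rightarrow> (real^2 \<Rightarrow> real^3) \<Rightarrow> real^2 \<Rightarrow> real" where
  "gauss_curvature g n x =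
    (let E = pdu g x \<bullet> pdu g x; F = pdu g x \<bullet> pdv g x; G = pdv g x \<bullet> pdv g x;
         L = pdu (pdu g) x \<bullet> n x; M = pdv (pdu g) x \<bullet> n x; N = pdv (pdv g) x \<bullet> n x
     in (L * N - M\<^sup>2) / (E * G - F\<^sup>2))"

definition mean_curvature :: "(real^2 \<Rightarrow> real^3) \<Rightarrow> (real^2 \<Rightarrow> real^3) \<Rightarrow> real^2 \<Rightarrow> real" where
  "mean_curvature g n x =
    (let E = pdu g x \<bullet> pdu g x; F = pdu g x \<bullet> pdv g x; G = pdv g x \<bullet> pdv g x;
         L = pdu (pdu g) x \<bullet> n x; M = pdv (pdu g) x \<bullet> n x; N = pdv (pdv g) x \<bullet> n x
     in (E * N - 2 * F * M + G * L) / (2 * (E * G - F\<^sup>2)))"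

section \<open>Invariants of cuspidal edges\<close>

text \<open>To be evaluated on the \<open>u\<close>-axis of an adapted coordinate system.\<close>

definition singular_curvature :: "(real^2 \<Rightarrow> real^3) \<Rightarrow> (real^2 \<Rightarrow> real^3) \<Rightarrow> real^2 \<Rightarrow> real" where
  "singular_curvature f \<nu> x =
     sgn (pdv (area_density f \<nu>) x) * (det3 (pdu f x) (pdu (pdu f) x) (\<nu> x) / norm (pdu f x) ^ 3)"

definition cuspidal_curvature :: "(real^2 \<Rightarrow> real^3) \<Rightarrow> real^2 \<Rightarrow> real" where
  "cuspidal_curvature f x =
     norm (pdu f x) powr (3/2) * det3 (pdu f x) (pdv (pdv f) x) (pdv (pdv (pdv f)) x)
       / norm (cross3 (pdu f x) (pdv (pdv f) x)) powr (5/2)"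

definition cusp_directional_torsion :: "(real^2 \<Rightarrow> real^3) \<Rightarrow> real^2 \<Rightarrow> real" where
  "cusp_directional_torsion f x =
     det3 (pdu f x) (pdv (pdv f) x) (pdv (pdv (pdu f)) x)
       / (norm (cross3 (pdu f x) (pdv (pdv f) x)))\<^sup>2
     - det3 (pdu f x) (pdv (pdv f) x) (pdu (pdu f) x) * (pdu f x \<bullet> pdv (pdv f) x)
       / ((norm (pdu f x))\<^sup>2 * (norm (cross3 (pdu f x) (pdv (pdv f) x)))\<^sup>2)"

end

theory Submission
  imports Defs
begin

text \<open>
  Write \<open>f\<close> in adapted coordinates, with \<open>f\<^sub>v = v h\<close>, and let \<open>w = \<langle>f\<^sub>u \<times> h, \<nu>\<rangle>\<close>. The front condition
  makes \<open>N = - \<langle>h, \<nu>\<^sub>v\<rangle>\<close> nonzero on the axis \<open>v = 0\<close> (\<open>tN_nonzero\<close>), and there \<open>w > 0\<close>. Hence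
  the discriminant under the square root is positive near \<open>0\<close>, and the focal surface is
  \<open>g = f + v r \<nu>\<close> with a smooth factor \<open>r\<close> whose value on the axis is \<open>w\<^sup>2 / (E N)\<close>, where
  \<open>E = \<langle>f\<^sub>u, f\<^sub>u\<rangle>\<close>.

  The curvatures of \<open>g\<close> on the axis need very little of \<open>r\<close>. There \<open>g\<^sub>u = f\<^sub>u\<close> and
  \<open>g\<^sub>v = r \<nu>\<close>, so \<open>g\<close> is an immersion near \<open>0\<close> and every unit normal \<open>n\<close> of \<open>g\<close> is a multiple of
  \<open>c = \<nu> \<times> f\<^sub>u\<close>; in particular \<open>n\<close> is orthogonal to \<open>\<nu>\<close>. All derivatives of \<open>r\<close> in the second
  derivatives of \<open>g\<close> multiply \<open>\<nu>\<close> or vanish with \<open>v\<close>, so that on the axis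
  \<open>g\<^sub>u\<^sub>u\<close>, \<open>g\<^sub>u\<^sub>v\<close>, \<open>g\<^sub>v\<^sub>v\<close> have the \<open>n\<close>-components of \<open>f\<^sub>u\<^sub>u\<close>, \<open>r \<nu>\<^sub>u\<close> and \<open>h + 2 r \<nu>\<^sub>v\<close>
  (\<open>axis_focal_derivatives\<close>). Expanding \<open>h\<close> in the orthogonal tangent frame \<open>f\<^sub>u\<close>, \<open>c\<close> expresses the
  \<open>c\<close>-components of \<open>\<nu>\<^sub>u\<close> and \<open>\<nu>\<^sub>v\<close> through the coefficients \<open>F\<close>, \<open>L\<close>, \<open>M\<close>, \<open>N\<close>; the three
  invariants of the cuspidal edge have equally short expressions in them
  (\<open>axis_invariants\<close>), and comparing the two is algebra (\<open>focal_curvatures_algebra\<close>).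

  The sign of the mean curvature is minus that of \<open>\<langle>n, c\<rangle>\<close>, a continuous function without zeros on the
  part of the axis inside a convex neighbourhood, hence of constant sign.
\<close>

section \<open>Calculus of smooth maps\<close>

definition dir_deriv ::
  "'a::real_normed_vector \<Rightarrow> ('a \<Rightarrow> 'b::real_normed_vector) \<Rightarrow> 'a \<Rightarrow> 'b" where
  "dir_deriv e f x = frechet_derivative f (at x) e"

lemma pdu_eq_dir_deriv: "pdu f = dir_deriv (axis 1 1) f"
  by (simp add: fun_eq_iff pdu_def dir_deriv_def)

lemma pdv_eq_dir_deriv: "pdv f = dir_deriv (axis 2 1) f"
  by (simp add: fun_eq_iff pdv_def dir_deriv_def)

lemma dir_deriv_eqI: "(f has_derivative D) (at x) \<Longrightarrow> dir_deriv e f x = D e"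
  by (simp add: dir_deriv_def frechet_derivative_at[symmetric])

lemma dir_deriv_cong:
  assumes "open S" "x \<in> S" "\<And>y. y \<in> S \<Longrightarrow> f y = g y" "f differentiable (at x)"
  shows "dir_deriv e f x = dir_deriv e g x"
  using frechet_derivative_transform_within_open[of f x S g] assms by (simp add: dir_deriv_def)

lemma times_differentiable_on_cong:
  assumes "open S" "\<And>x. x \<in> S \<Longrightarrow> f x = g x" "times_differentiable_on n S f"
  shows "times_differentiable_on n S g"
  using assms(2,3)
proof (induction n arbitrary: f g)
  case 0
  then show ?case by (simp cong: continuous_on_cong)
next
  case (Suc n)
  have "g differentiable (at x)" if "x \<in> S" for x
    using Suc.prems assms(1) that
    by (metis differentiable_def has_derivative_transform_within_open times_differentiable_on.simps(2))
  moreover have "times_differentiable_on n S (\<lambda>x. frechet_derivative g (at x) X)" for X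
  proof (rule Suc.IH)
    show "times_differentiable_on n S (\<lambda>x. frechet_derivative f (at x) X)"
      using Suc.prems by simp
    show "frechet_derivative f (at x) X = frechet_derivative g (at x) X" if "x \<in> S" for x
      using frechet_derivative_transform_within_open[of f x S g] Suc.prems assms(1) that by simp
  qed
  ultimately show ?case by simp
qed

text \<open>The introduction rule for any explicitly known derivative; the closure properties below are
  inductions that apply it to the usual rules of differentiation.\<close>

lemma times_differentiable_on_SucI:
  assumes "open S" "\<And>x. x \<in> S \<Longrightarrow> (f has_derivative D x) (at x)"
    and "\<And>X. times_differentiable_on n S (\<lambda>x. D x X)"
  shows "times_differentiable_on (Suc n) S f"
proof -
  have "times_differentiable_on n S (\<lambda>x. frechet_derivative f (at x) X)" for X
    by (rule times_differentiable_on_cong[OF assms(1) _ assms(3)[of X]])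
       (simp add: frechet_derivative_at[OF assms(2)])
  then show ?thesis
    using assms(2) by (auto intro: differentiableI)
qed

lemma times_differentiable_on_SucD:
  assumes "times_differentiable_on (Suc n) S f" "x \<in> S"
  shows "(f has_derivative frechet_derivative f (at x)) (at x)"
  using assms by (simp add: frechet_derivative_works)

lemma times_differentiable_on_pred:
  "times_differentiable_on (Suc n) S f \<Longrightarrow> times_differentiable_on n S f"
proof (induction n arbitrary: f)
  case 0
  then show ?case
    by (auto intro!: continuous_at_imp_continuous_on differentiable_imp_continuous_within)
next
  case (Suc n)
  then show ?case by (meson times_differentiable_on.simps(2))
qed

lemma times_differentiable_on_const: "times_differentiable_on n S (\<lambda>x. c)"
  by (induction n arbitrary: c) auto

lemma times_differentiable_on_bounded_linear:
  assumes "bounded_linear L" "open S" "times_differentiable_on n S f"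
  shows "times_differentiable_on n S (\<lambda>x. L (f x))"
  using assms(3)
proof (induction n arbitrary: f)
  case 0
  then show ?case using bounded_linear.continuous_on[OF assms(1)] by simp
next
  case (Suc n)
  show ?case
    using Suc.prems Suc.IH times_differentiable_on_SucD[OF Suc.prems]
    by (intro times_differentiable_on_SucI[where D="\<lambda>x X. L (frechet_derivative f (at x) X)"])
       (auto intro!: bounded_linear.has_derivative[OF assms(1)] assms)
qed

lemma times_differentiable_on_add:
  assumes "open S" "times_differentiable_on n S f" "times_differentiable_on n S g"
  shows "times_differentiable_on n S (\<lambda>x. f x + g x)"
  using assms(2,3)
proof (induction n arbitrary: f g)
  case 0
  then show ?case by (simp add: continuous_on_add)
next
  case (Suc n)
  show ?case
    using Suc.prems Suc.IH times_differentiable_on_SucD[OF Suc.prems(1)]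
      times_differentiable_on_SucD[OF Suc.prems(2)]
    by (intro times_differentiable_on_SucI[where
          D="\<lambda>x X. frechet_derivative f (at x) X + frechet_derivative g (at x) X"])
       (auto intro!: has_derivative_add assms)
qed

lemma times_differentiable_on_bilinear:
  assumes "bounded_bilinear B" "open S"
    "times_differentiable_on n S f" "times_differentiable_on n S g"
  shows "times_differentiable_on n S (\<lambda>x. B (f x) (g x))"
  using assms(3,4)
proof (induction n arbitrary: f g)
  case 0
  then show ?case using bounded_bilinear.continuous_on[OF assms(1)] by simp
next
  case (Suc n)
  show ?case
    using Suc.prems Suc.IH times_differentiable_on_SucD[OF Suc.prems(1)]
      times_differentiable_on_SucD[OF Suc.prems(2)]
      times_differentiable_on_pred[OF Suc.prems(1)] times_differentiable_on_pred[OF Suc.prems(2)]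
    by (intro times_differentiable_on_SucI[where
          D="\<lambda>x X. B (f x) (frechet_derivative g (at x) X) + B (frechet_derivative f (at x) X) (g x)"])
       (auto intro!: bounded_bilinear.FDERIV[OF assms(1)] times_differentiable_on_add assms)
qed

lemma times_differentiable_on_sum:
  assumes "open S" "finite I" "\<And>i. i \<in> I \<Longrightarrow> times_differentiable_on n S (f i)"
  shows "times_differentiable_on n S (\<lambda>x. \<Sum>i\<in>I. f i x)"
  using assms(2,3)
  by (induction I rule: finite_induct)
     (auto intro: times_differentiable_on_const times_differentiable_on_add[OF assms(1)])

text \<open>The chain rule produces the derivative of \<open>f\<close> in a direction that varies with the point.
  Expanding that direction in a basis leaves derivatives of \<open>f\<close> in constant directions only, and to
  these the induction hypothesis applies.\<close>

lemma times_differentiable_on_compose: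
  fixes g :: "'a::real_normed_vector \<Rightarrow> 'b::euclidean_space"
  assumes "open S" "open T" "g ` S \<subseteq> T"
    "times_differentiable_on n T f" "times_differentiable_on n S g"
  shows "times_differentiable_on n S (\<lambda>x. f (g x))"
  using assms(4,5)
proof (induction n arbitrary: f)
  case 0
  then show ?case using assms(3) by (auto intro: continuous_on_compose2)
next
  case (Suc n)
  let ?f' = "\<lambda>y. frechet_derivative f (at y)" and ?g' = "\<lambda>x. frechet_derivative g (at x)"
  have g': "(g has_derivative ?g' x) (at x)" if "x \<in> S" for x
    using times_differentiable_on_SucD[OF Suc.prems(2) that] .
  have f': "(f has_derivative ?f' (g x)) (at (g x))" if "x \<in> S" for x
    using times_differentiable_on_SucD[OF Suc.prems(1)] assms(3) that by blast
  show ?case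
  proof (rule times_differentiable_on_SucI[where
        D="\<lambda>x X. \<Sum>b\<in>Basis. (?g' x X \<bullet> b) *\<^sub>R ?f' (g x) b"])
    show "((\<lambda>x. f (g x)) has_derivative (\<lambda>X. \<Sum>b\<in>Basis. (?g' x X \<bullet> b) *\<^sub>R ?f' (g x) b)) (at x)"
      if "x \<in> S" for x
    proof -
      have lin: "linear (?f' (g x))"
        using f'[OF that] has_derivative_linear by blast
      have expand: "?f' (g x) y = (\<Sum>b\<in>Basis. (y \<bullet> b) *\<^sub>R ?f' (g x) b)" for y
      proof -
        have "?f' (g x) y = ?f' (g x) (\<Sum>b\<in>Basis. (y \<bullet> b) *\<^sub>R b)"
          by (simp add: euclidean_representation)
        then show ?thesis
          by (simp add: linear_sum[OF lin] linear_scale[OF lin])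
      qed
      have "(\<lambda>X. \<Sum>b\<in>Basis. (?g' x X \<bullet> b) *\<^sub>R ?f' (g x) b) = (\<lambda>X. ?f' (g x) (?g' x X))"
        by (rule ext) (rule expand[symmetric])
      then show ?thesis
        using has_derivative_compose[OF g'[OF that] f'[OF that]] by (simp only:)
    qed
    show "times_differentiable_on n S (\<lambda>x. \<Sum>b\<in>Basis. (?g' x X \<bullet> b) *\<^sub>R ?f' (g x) b)" for X
    proof (rule times_differentiable_on_sum[OF assms(1) finite_Basis])
      fix b :: 'b
      have "times_differentiable_on n S (\<lambda>x. ?g' x X \<bullet> b)"
        using Suc.prems(2)
        by (simp add: times_differentiable_on_bounded_linear[OF bounded_linear_inner_left assms(1)])
      moreover have "times_differentiable_on n S (\<lambda>x. ?f' (g x) b)"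
        using Suc.IH[of "\<lambda>y. ?f' y b"] Suc.prems(1) times_differentiable_on_pred[OF Suc.prems(2)]
        by simp
      ultimately show "times_differentiable_on n S (\<lambda>x. (?g' x X \<bullet> b) *\<^sub>R ?f' (g x) b)"
        by (rule times_differentiable_on_bilinear[OF bounded_bilinear_scaleR assms(1)])
    qed
  qed (rule assms(1))
qed

lemma times_differentiable_on_inverse:
  fixes f :: "'a::real_normed_vector \<Rightarrow> real"
  assumes "open S" "\<And>x. x \<in> S \<Longrightarrow> f x \<noteq> 0" "times_differentiable_on n S f"
  shows "times_differentiable_on n S (\<lambda>x. inverse (f x))"
  using assms(3)
proof (induction n)
  case 0
  then show ?case using assms(2) by (auto intro: continuous_on_inverse)
next
  case (Suc n)
  have IH: "times_differentiable_on n S (\<lambda>x. inverse (f x))"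
    using Suc times_differentiable_on_pred by blast
  have "times_differentiable_on n S (\<lambda>x. - (inverse (f x) * frechet_derivative f (at x) X * inverse (f x)))" for X
    using Suc.prems IH
    by (intro times_differentiable_on_bounded_linear[OF bounded_linear_minus[OF bounded_linear_ident]]
        times_differentiable_on_bilinear[OF bounded_bilinear_mult] assms(1)) auto
  then show ?case
    using times_differentiable_on_SucD[OF Suc.prems] assms(2)
    by (intro times_differentiable_on_SucI[OF assms(1)]) (auto intro!: Deriv.has_derivative_inverse)
qed

lemma times_differentiable_on_sqrt:
  fixes f :: "'a::real_normed_vector \<Rightarrow> real"
  assumes "open S" "\<And>x. x \<in> S \<Longrightarrow> f x > 0" "times_differentiable_on n S f"
  shows "times_differentiable_on n S (\<lambda>x. sqrt (f x))"
  using assms(3)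
proof (induction n)
  case 0
  then show ?case by (auto intro: continuous_on_real_sqrt)
next
  case (Suc n)
  have IH: "times_differentiable_on n S (\<lambda>x. sqrt (f x))"
    using Suc times_differentiable_on_pred by blast
  have nz: "sqrt (f x) \<noteq> 0" if "x \<in> S" for x
    using assms(2)[OF that] by simp
  have "times_differentiable_on n S (\<lambda>x. frechet_derivative f (at x) X * (inverse (sqrt (f x)) * (1/2)))" for X
    using Suc.prems IH nz
    by (intro times_differentiable_on_bilinear[OF bounded_bilinear_mult]
        times_differentiable_on_inverse times_differentiable_on_const assms(1)) auto
  moreover have "((\<lambda>x. sqrt (f x)) has_derivative
      (\<lambda>X. frechet_derivative f (at x) X * (inverse (sqrt (f x)) * (1/2)))) (at x)" if "x \<in> S" for x
    using times_differentiable_on_SucD[OF Suc.prems that] assms(2)[OF that]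
    by (auto intro!: derivative_eq_intros simp: field_simps)
  ultimately show ?case
    by (intro times_differentiable_on_SucI[OF assms(1)])
qed

lemma smooth_on_subset:
  assumes "smooth_on S f" "T \<subseteq> S"
  shows "smooth_on T f"
proof -
  have "times_differentiable_on n S f \<Longrightarrow> times_differentiable_on n T f" for n
    using assms(2) by (induction n arbitrary: f) (auto intro: continuous_on_subset)
  then show ?thesis using assms by (simp add: smooth_on_def)
qed

lemma smooth_on_cong:
  "open S \<Longrightarrow> smooth_on S f \<Longrightarrow> (\<And>x. x \<in> S \<Longrightarrow> f x = g x) \<Longrightarrow> smooth_on S g"
  unfolding smooth_on_def using times_differentiable_on_cong by metis

lemma smooth_on_has_derivative:
  "smooth_on S f \<Longrightarrow> x \<in> S \<Longrightarrow> (f has_derivative frechet_derivative f (at x)) (at x)"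
  unfolding smooth_on_def using times_differentiable_on_SucD by blast

lemma smooth_on_differentiable: "smooth_on S f \<Longrightarrow> x \<in> S \<Longrightarrow> f differentiable (at x)"
  using smooth_on_has_derivative differentiableI by blast

lemma smooth_on_has_dir_deriv:
  "smooth_on S f \<Longrightarrow> x \<in> S \<Longrightarrow> (f has_derivative (\<lambda>e. dir_deriv e f x)) (at x)"
  unfolding dir_deriv_def by (rule smooth_on_has_derivative)

lemma smooth_on_imp_continuous_on: "smooth_on S f \<Longrightarrow> continuous_on S f"
  unfolding smooth_on_def by (metis times_differentiable_on.simps(1))

lemma smooth_on_dir_deriv: "smooth_on S f \<Longrightarrow> smooth_on S (dir_deriv e f)"
  unfolding smooth_on_def dir_deriv_def by (metis times_differentiable_on.simps(2))

lemma smooth_on_const: "smooth_on S (\<lambda>x. c)"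
  by (simp add: smooth_on_def times_differentiable_on_const)

lemma smooth_on_bounded_linear:
  "bounded_linear L \<Longrightarrow> open S \<Longrightarrow> smooth_on S f \<Longrightarrow> smooth_on S (\<lambda>x. L (f x))"
  by (simp add: smooth_on_def times_differentiable_on_bounded_linear)

lemma smooth_on_ident: "smooth_on S (\<lambda>x. x)"
proof -
  have "times_differentiable_on n S (\<lambda>x::'a. x)" for n
    by (cases n) (auto simp: times_differentiable_on_const)
  then show ?thesis by (simp add: smooth_on_def)
qed

lemma smooth_on_add:
  "open S \<Longrightarrow> smooth_on S f \<Longrightarrow> smooth_on S g \<Longrightarrow> smooth_on S (\<lambda>x. f x + g x)"
  by (simp add: smooth_on_def times_differentiable_on_add)

lemma smooth_on_minus: "open S \<Longrightarrow> smooth_on S f \<Longrightarrow> smooth_on S (\<lambda>x. - f x)"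
  by (rule smooth_on_bounded_linear[OF bounded_linear_minus[OF bounded_linear_ident]])

lemma smooth_on_diff:
  "open S \<Longrightarrow> smooth_on S f \<Longrightarrow> smooth_on S g \<Longrightarrow> smooth_on S (\<lambda>x. f x - g x)"
  using smooth_on_add[OF _ _ smooth_on_minus, of S f g] by simp

lemma smooth_on_bilinear:
  "bounded_bilinear B \<Longrightarrow> open S \<Longrightarrow> smooth_on S f \<Longrightarrow> smooth_on S g
    \<Longrightarrow> smooth_on S (\<lambda>x. B (f x) (g x))"
  by (simp add: smooth_on_def times_differentiable_on_bilinear)

lemmas smooth_on_mult = smooth_on_bilinear[OF bounded_bilinear_mult]
lemmas smooth_on_scaleR = smooth_on_bilinear[OF bounded_bilinear_scaleR]
lemmas smooth_on_inner = smooth_on_bilinear[OF bounded_bilinear_inner]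

lemma bounded_bilinear_cross3: "bounded_bilinear cross3"
  using bilinear_cross bilinear_conv_bounded_bilinear by blast

lemmas smooth_on_cross3 = smooth_on_bilinear[OF bounded_bilinear_cross3]

lemma smooth_on_compose:
  fixes g :: "'a::real_normed_vector \<Rightarrow> 'b::euclidean_space"
  shows "open S \<Longrightarrow> open T \<Longrightarrow> g ` S \<subseteq> T \<Longrightarrow> smooth_on T f \<Longrightarrow> smooth_on S g
    \<Longrightarrow> smooth_on S (\<lambda>x. f (g x))"
  by (simp add: smooth_on_def times_differentiable_on_compose)

lemma smooth_on_divide:
  fixes f g :: "'a::real_normed_vector \<Rightarrow> real"
  shows "open S \<Longrightarrow> smooth_on S f \<Longrightarrow> smooth_on S g \<Longrightarrow> (\<And>x. x \<in> S \<Longrightarrow> g x \<noteq> 0)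
    \<Longrightarrow> smooth_on S (\<lambda>x. f x / g x)"
  unfolding divide_inverse
  by (intro smooth_on_mult) (simp_all add: smooth_on_def times_differentiable_on_inverse)

lemma smooth_on_sqrt:
  fixes f :: "'a::real_normed_vector \<Rightarrow> real"
  shows "open S \<Longrightarrow> smooth_on S f \<Longrightarrow> (\<And>x. x \<in> S \<Longrightarrow> f x > 0) \<Longrightarrow> smooth_on S (\<lambda>x. sqrt (f x))"
  by (simp add: smooth_on_def times_differentiable_on_sqrt)

lemma smooth_on_component: "smooth_on S (\<lambda>x::real^'n. x $ i)"
  by (rule smooth_on_subset[OF _ subset_UNIV])
     (rule smooth_on_bounded_linear[OF bounded_linear_vec_nth open_UNIV smooth_on_ident])

lemmas smooth_on_intros =
  smooth_on_dir_deriv smooth_on_const smooth_on_component smooth_on_add smooth_on_minus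
  smooth_on_diff smooth_on_mult smooth_on_scaleR smooth_on_inner smooth_on_cross3

lemma dir_deriv_bilinear:
  assumes "bounded_bilinear B" "smooth_on S f" "smooth_on S g" "x \<in> S"
  shows "dir_deriv e (\<lambda>x. B (f x) (g x)) x = B (f x) (dir_deriv e g x) + B (dir_deriv e f x) (g x)"
  by (rule dir_deriv_eqI)
     (rule bounded_bilinear.FDERIV[OF assms(1) smooth_on_has_dir_deriv[OF assms(2,4)]
        smooth_on_has_dir_deriv[OF assms(3,4)]])

lemmas dir_deriv_scaleR = dir_deriv_bilinear[OF bounded_bilinear_scaleR]
lemmas dir_deriv_inner = dir_deriv_bilinear[OF bounded_bilinear_inner]

lemma dir_deriv_add:
  assumes "smooth_on S f" "smooth_on S g" "x \<in> S"
  shows "dir_deriv e (\<lambda>x. f x + g x) x = dir_deriv e f x + dir_deriv e g x"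
  by (rule dir_deriv_eqI) 
     (rule has_derivative_add[OF smooth_on_has_dir_deriv[OF assms(1,3)] smooth_on_has_dir_deriv[OF assms(2,3)]])

lemma dir_deriv_component: "dir_deriv e (\<lambda>x::real^'n. x $ i) x = e $ i"
  by (rule dir_deriv_eqI)
     (rule bounded_linear.has_derivative[OF bounded_linear_vec_nth has_derivative_ident])

lemma dir_deriv_const: "dir_deriv e (\<lambda>x. c) x = 0"
  by (simp add: dir_deriv_def)

text \<open>Two applications of the mean value theorem, first in the direction \<open>d\<close> and then in the
  direction \<open>e\<close>, express a second difference through the mixed derivative. The second difference is
  symmetric in \<open>d\<close> and \<open>e\<close>, so shrinking the parallelogram will identify the two mixed
  derivatives.\<close>

lemma second_difference_eq_mixed_derivative:
  fixes f :: "'a::real_normed_vector \<Rightarrow> real"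
  assumes f: "smooth_on S f" and "s > 0"
    and par: "\<And>a b. 0 \<le> a \<Longrightarrow> a \<le> s \<Longrightarrow> 0 \<le> b \<Longrightarrow> b \<le> s \<Longrightarrow> x + a *\<^sub>R d + b *\<^sub>R e \<in> S"
  obtains a b where "0 \<le> a" "a \<le> s" "0 \<le> b" "b \<le> s"
    "f (x + s *\<^sub>R d + s *\<^sub>R e) - f (x + s *\<^sub>R d) - f (x + s *\<^sub>R e) + f x
       = s\<^sup>2 * dir_deriv e (dir_deriv d f) (x + a *\<^sub>R d + b *\<^sub>R e)"
proof -
  have along: "((\<lambda>t. F (c + t *\<^sub>R w)) has_real_derivative dir_deriv w F (c + t *\<^sub>R w)) (at t)"
    if "smooth_on S F" "c + t *\<^sub>R w \<in> S" for F :: "'a \<Rightarrow> real" and c w t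
  proof -
    have lin: "linear (\<lambda>e. dir_deriv e F (c + t *\<^sub>R w))"
      using smooth_on_has_dir_deriv[OF that] has_derivative_linear by blast
    have "((\<lambda>t. c + t *\<^sub>R w) has_derivative (\<lambda>k. k *\<^sub>R w)) (at t)"
      by (auto intro!: derivative_eq_intros)
    from has_derivative_compose[OF this smooth_on_has_dir_deriv[OF that]]
    show ?thesis
      by (simp add: has_field_derivative_def linear_scale[OF lin] mult.commute[of _ "dir_deriv w F _"])
  qed
  let ?\<phi> = "\<lambda>t. f ((x + s *\<^sub>R e) + t *\<^sub>R d) - f (x + t *\<^sub>R d)"
  have \<phi>': "(?\<phi> has_real_derivative
      dir_deriv d f ((x + s *\<^sub>R e) + t *\<^sub>R d) - dir_deriv d f (x + t *\<^sub>R d)) (at t)"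
    if "0 \<le> t" "t \<le> s" for t
    using par[of t s] par[of t 0] that \<open>s > 0\<close>
    by (intro DERIV_diff along[OF f]) (auto simp: algebra_simps)
  obtain a where a: "0 < a" "a < s" "?\<phi> s - ?\<phi> 0 =
      (s - 0) * (dir_deriv d f ((x + s *\<^sub>R e) + a *\<^sub>R d) - dir_deriv d f (x + a *\<^sub>R d))"
    using MVT2[of 0 s ?\<phi> "\<lambda>t. dir_deriv d f ((x + s *\<^sub>R e) + t *\<^sub>R d) - dir_deriv d f (x + t *\<^sub>R d)",
        OF \<open>s > 0\<close> \<phi>'] by blast
  have \<psi>': "((\<lambda>t. dir_deriv d f ((x + a *\<^sub>R d) + t *\<^sub>R e)) has_real_derivative
      dir_deriv e (dir_deriv d f) ((x + a *\<^sub>R d) + t *\<^sub>R e)) (at t)" if "0 \<le> t" "t \<le> s" for t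
    using par[of a t] that a by (intro along smooth_on_dir_deriv f) auto
  obtain b where b: "0 < b" "b < s" "dir_deriv d f ((x + a *\<^sub>R d) + s *\<^sub>R e)
      - dir_deriv d f ((x + a *\<^sub>R d) + 0 *\<^sub>R e)
      = (s - 0) * dir_deriv e (dir_deriv d f) ((x + a *\<^sub>R d) + b *\<^sub>R e)"
    using MVT2[of 0 s "\<lambda>t. dir_deriv d f ((x + a *\<^sub>R d) + t *\<^sub>R e)"
        "\<lambda>t. dir_deriv e (dir_deriv d f) ((x + a *\<^sub>R d) + t *\<^sub>R e)", OF \<open>s > 0\<close> \<psi>']
    by blast
  show ?thesis
  proof (rule that[of a b])
    have "f (x + s *\<^sub>R d + s *\<^sub>R e) - f (x + s *\<^sub>R d) - f (x + s *\<^sub>R e) + f x = ?\<phi> s - ?\<phi> 0"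
      by (simp add: algebra_simps)
    also have "\<dots> = s * (dir_deriv d f ((x + a *\<^sub>R d) + s *\<^sub>R e)
        - dir_deriv d f ((x + a *\<^sub>R d) + 0 *\<^sub>R e))"
      using a(3) by (simp add: algebra_simps)
    also have "\<dots> = s\<^sup>2 * dir_deriv e (dir_deriv d f) (x + a *\<^sub>R d + b *\<^sub>R e)"
      unfolding b(3) by (simp add: power2_eq_square)
    finally show "f (x + s *\<^sub>R d + s *\<^sub>R e) - f (x + s *\<^sub>R d) - f (x + s *\<^sub>R e) + f x
       = s\<^sup>2 * dir_deriv e (dir_deriv d f) (x + a *\<^sub>R d + b *\<^sub>R e)" .
  qed (use a b in auto)
qed

lemma mixed_derivatives_commute_real:
  fixes f :: "'a::real_normed_vector \<Rightarrow> real"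
  assumes "open S" and f: "smooth_on S f" and "x \<in> S"
  shows "dir_deriv e (dir_deriv d f) x = dir_deriv d (dir_deriv e f) x"
proof (rule ccontr)
  let ?P = "dir_deriv e (dir_deriv d f)" and ?Q = "dir_deriv d (dir_deriv e f)"
  assume "?P x \<noteq> ?Q x"
  define \<epsilon> where "\<epsilon> = \<bar>?P x - ?Q x\<bar> / 2"
  have "\<epsilon> > 0" using \<open>?P x \<noteq> ?Q x\<close> by (simp add: \<epsilon>_def)
  have "(?P \<longlongrightarrow> ?P x) (nhds x)" "(?Q \<longlongrightarrow> ?Q x) (nhds x)"
    unfolding tendsto_at_iff_tendsto_nhds[symmetric] isCont_def[symmetric]
    using smooth_on_imp_continuous_on[OF smooth_on_dir_deriv[OF smooth_on_dir_deriv[OF f]]] assms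
    by (auto simp: continuous_on_eq_continuous_at)
  then have "\<forall>\<^sub>F y in nhds x. dist (?P y) (?P x) < \<epsilon> \<and> dist (?Q y) (?Q x) < \<epsilon> \<and> y \<in> S"
    using \<open>\<epsilon> > 0\<close> assms(1,3) by (intro eventually_conj tendstoD eventually_nhds_in_open)
  then obtain \<delta> where "\<delta> > 0" and \<delta>:
    "\<And>y. dist y x < \<delta> \<Longrightarrow> dist (?P y) (?P x) < \<epsilon> \<and> dist (?Q y) (?Q x) < \<epsilon> \<and> y \<in> S"
    by (auto simp: eventually_nhds_metric)
  \<comment> \<open>Parallelograms of this side length stay in the ball of radius \<open>\<delta>\<close>, also for \<open>d = e = 0\<close>.\<close>
  define s where "s = \<delta> / (norm d + norm e + 1)"
  have "norm d + norm e + 1 > 0"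
    by (smt (verit) norm_ge_zero)
  then have "s > 0" and s: "s * (norm d + norm e) < \<delta>"
    using \<open>\<delta> > 0\<close> by (simp_all add: s_def field_simps)
  have near: "dist (x + a *\<^sub>R d + b *\<^sub>R e) x < \<delta>" if "0 \<le> a" "a \<le> s" "0 \<le> b" "b \<le> s" for a b
  proof -
    have "dist (x + a *\<^sub>R d + b *\<^sub>R e) x \<le> a * norm d + b * norm e"
      using norm_triangle_ineq[of "a *\<^sub>R d" "b *\<^sub>R e"] that by (simp add: dist_norm algebra_simps)
    also have "\<dots> \<le> s * (norm d + norm e)"
      using that by (simp add: distrib_left add_mono mult_right_mono)
    finally show ?thesis using s by simp
  qed
  obtain a b where ab: "0 \<le> a" "a \<le> s" "0 \<le> b" "b \<le> s"
    "f (x + s *\<^sub>R d + s *\<^sub>R e) - f (x + s *\<^sub>R d) - f (x + s *\<^sub>R e) + f x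
       = s\<^sup>2 * ?P (x + a *\<^sub>R d + b *\<^sub>R e)"
    using second_difference_eq_mixed_derivative[OF f \<open>s > 0\<close>, of x d e] near \<delta> by metis
  have near': "x + a *\<^sub>R e + b *\<^sub>R d \<in> S" if "0 \<le> a" "a \<le> s" "0 \<le> b" "b \<le> s" for a b
    using \<delta>[OF near[of b a]] that by (simp add: algebra_simps)
  obtain a' b' where ab': "0 \<le> a'" "a' \<le> s" "0 \<le> b'" "b' \<le> s"
    "f (x + s *\<^sub>R e + s *\<^sub>R d) - f (x + s *\<^sub>R e) - f (x + s *\<^sub>R d) + f x
       = s\<^sup>2 * ?Q (x + a' *\<^sub>R e + b' *\<^sub>R d)"
    using second_difference_eq_mixed_derivative[OF f \<open>s > 0\<close>, of x e d] near' by metis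
  have swap: "x + a' *\<^sub>R e + b' *\<^sub>R d = x + b' *\<^sub>R d + a' *\<^sub>R e"
    "x + s *\<^sub>R e + s *\<^sub>R d = x + s *\<^sub>R d + s *\<^sub>R e"
    by (simp_all add: algebra_simps)
  have "s\<^sup>2 * ?P (x + a *\<^sub>R d + b *\<^sub>R e) = s\<^sup>2 * ?Q (x + b' *\<^sub>R d + a' *\<^sub>R e)"
    using ab(5) ab'(5) unfolding swap by linarith
  then have "?P (x + a *\<^sub>R d + b *\<^sub>R e) = ?Q (x + b' *\<^sub>R d + a' *\<^sub>R e)"
    using \<open>s > 0\<close> by simp
  moreover have "dist (?P (x + a *\<^sub>R d + b *\<^sub>R e)) (?P x) < \<epsilon>"
    using \<delta>[OF near] ab by blast
  moreover have "dist (?Q (x + b' *\<^sub>R d + a' *\<^sub>R e)) (?Q x) < \<epsilon>"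
    using \<delta>[OF near] ab' by blast
  ultimately show False
    unfolding \<epsilon>_def dist_real_def by (smt (verit) field_sum_of_halves)
qed

lemma mixed_derivatives_commute:
  fixes f :: "'a::real_normed_vector \<Rightarrow> 'b::real_inner"
  assumes "open S" and f: "smooth_on S f" and "x \<in> S"
  shows "dir_deriv e (dir_deriv d f) x = dir_deriv d (dir_deriv e f) x"
proof -
  have inner: "dir_deriv e (\<lambda>x. F x \<bullet> k) y = dir_deriv e F y \<bullet> k" if "smooth_on S F" "y \<in> S"
    for F :: "'a \<Rightarrow> 'b" and e k y
    using dir_deriv_inner[OF that(1) smooth_on_const that(2)] by (simp add: dir_deriv_const)
  have twice: "dir_deriv e (dir_deriv d (\<lambda>x. f x \<bullet> k)) x = dir_deriv e (dir_deriv d f) x \<bullet> k" for d e k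
  proof -
    have "dir_deriv e (dir_deriv d (\<lambda>x. f x \<bullet> k)) x = dir_deriv e (\<lambda>y. dir_deriv d f y \<bullet> k) x"
      using assms inner[OF f]
      by (intro dir_deriv_cong[of S] smooth_on_differentiable[of S] smooth_on_intros) auto
    also have "\<dots> = dir_deriv e (dir_deriv d f) x \<bullet> k"
      by (rule inner[OF smooth_on_dir_deriv[OF f] \<open>x \<in> S\<close>])
    finally show ?thesis .
  qed
  have "dir_deriv e (dir_deriv d f) x \<bullet> k = dir_deriv d (dir_deriv e f) x \<bullet> k" for k
    using mixed_derivatives_commute_real[OF assms(1) smooth_on_inner[OF assms(1) f smooth_on_const] assms(3),
        of e d k] by (simp add: twice)
  then show ?thesis by (metis vector_eq_rdot)
qed

section \<open>Vector algebra in three-space\<close>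

lemma det3_eq_cross_inner: "det3 a b c = cross3 a b \<bullet> c"
  by (simp add: det3_def dot_cross_det[symmetric] cross3_simps)

lemma cross3_inner_rotate: "cross3 a b \<bullet> c = b \<bullet> cross3 c a"
  by (simp add: cross3_simps)

lemma cross3_tangent_vectors:
  fixes n :: "real^3"
  assumes "n \<bullet> n = 1" "a \<bullet> n = 0" "b \<bullet> n = 0"
  shows "cross3 a b = (cross3 a b \<bullet> n) *\<^sub>R n"
proof -
  have "cross3 n (cross3 a b) = 0"
    using assms by (simp add: Lagrange inner_commute)
  then have "cross3 n (cross3 n (cross3 a b)) = 0"
    by simp
  then show ?thesis
    using assms(1) Lagrange[of n n "cross3 a b"] by (simp add: inner_commute)
qed

text \<open>The tangent vectors \<open>a\<close> and \<open>cross3 n a\<close> are orthogonal and of the same length, so this is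
  Parseval's identity in the tangent plane without normalization of the frame.\<close>

lemma inner_tangent_expand:
  fixes n :: "real^3"
  assumes "n \<bullet> n = 1" "a \<bullet> n = 0" "y \<bullet> n = 0"
  shows "(a \<bullet> a) * (y \<bullet> z) = (y \<bullet> a) * (z \<bullet> a) + (y \<bullet> cross3 n a) * (z \<bullet> cross3 n a)"
proof -
  let ?c = "cross3 n a"
  \<comment> \<open>Since \<open>a \<times> c\<close> is a multiple of \<open>n\<close>, the triple product \<open>y \<times> (a \<times> c)\<close> is \<open>y\<close> rotated by a right
    angle in the tangent plane and scaled; a further product with \<open>n\<close> rotates it back.\<close>
  have "(a \<bullet> a) *\<^sub>R cross3 y n = (y \<bullet> ?c) *\<^sub>R a - (y \<bullet> a) *\<^sub>R ?c"
    using Lagrange[of y a ?c] Lagrange[of a n a] assms by (simp add: cross_mult_right)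
  then have "cross3 n ((a \<bullet> a) *\<^sub>R cross3 y n) = cross3 n ((y \<bullet> ?c) *\<^sub>R a - (y \<bullet> a) *\<^sub>R ?c)"
    by simp
  moreover have "cross3 n ((a \<bullet> a) *\<^sub>R cross3 y n) = (a \<bullet> a) *\<^sub>R y"
    using assms by (simp add: cross_mult_right Lagrange inner_commute)
  moreover have "cross3 n ((y \<bullet> ?c) *\<^sub>R a - (y \<bullet> a) *\<^sub>R ?c) = (y \<bullet> ?c) *\<^sub>R ?c + (y \<bullet> a) *\<^sub>R a"
    using assms by (simp add: Lagrange inner_commute cross_mult_right left_diff_distrib
        right_diff_distrib diff_conv_add_uminus cross_add_right del: add_uminus_conv_diff)
  ultimately have "(a \<bullet> a) *\<^sub>R y = (y \<bullet> ?c) *\<^sub>R ?c + (y \<bullet> a) *\<^sub>R a"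
    by simp
  then have "((a \<bullet> a) *\<^sub>R y) \<bullet> z = ((y \<bullet> ?c) *\<^sub>R ?c + (y \<bullet> a) *\<^sub>R a) \<bullet> z"
    by simp
  then show ?thesis
    unfolding inner_add_left inner_scaleR_left by (simp add: inner_commute algebra_simps)
qed

lemma linear_inj_if_cross3_nonzero:
  fixes L :: "real^2 \<Rightarrow> real^3"
  assumes "linear L" and nz: "cross3 (L (axis 1 1)) (L (axis 2 1)) \<noteq> 0"
  shows "inj L"
  unfolding linear_injective_0[OF assms(1)]
proof (intro allI impI)
  fix X assume "L X = 0"
  have "X = X$1 *\<^sub>R axis 1 1 + X$2 *\<^sub>R axis 2 1"
    by (simp add: vec_eq_iff forall_2 axis_def)
  then have "L X = X$1 *\<^sub>R L (axis 1 1) + X$2 *\<^sub>R L (axis 2 1)"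
    by (metis linear_add[OF assms(1)] linear_scale[OF assms(1)])
  with \<open>L X = 0\<close> have "X$1 *\<^sub>R L (axis 1 1) + X$2 *\<^sub>R L (axis 2 1) = 0"
    by simp
  then have "cross3 (X$1 *\<^sub>R L (axis 1 1) + X$2 *\<^sub>R L (axis 2 1)) (L (axis 2 1)) = 0"
    "cross3 (L (axis 1 1)) (X$1 *\<^sub>R L (axis 1 1) + X$2 *\<^sub>R L (axis 2 1)) = 0"
    by simp_all
  then have "X$1 = 0 \<and> X$2 = 0"
    using nz by (simp add: cross_add_left cross_add_right cross_mult_left cross_mult_right)
  then show "X = 0"
    by (simp add: vec_eq_iff forall_2)
qed

lemma connected_nonzero_same_sign:
  fixes k :: "'a::topological_space \<Rightarrow> real"
  assumes "connected S" "continuous_on S k" "\<And>x. x \<in> S \<Longrightarrow> k x \<noteq> 0" "x \<in> S" "y \<in> S"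
  shows "sgn (k x) = sgn (k y)"
proof (rule ccontr)
  assume "sgn (k x) \<noteq> sgn (k y)"
  then have "k x \<le> 0 \<and> 0 \<le> k y \<or> k y \<le> 0 \<and> 0 \<le> k x"
    by (auto simp: sgn_if split: if_splits)
  moreover have "connected (k ` S)"
    using assms by (intro connected_continuous_image)
  ultimately have "0 \<in> k ` S"
    using assms(4,5) connectedD_interval[of "k ` S" "k x" "k y" 0]
      connectedD_interval[of "k ` S" "k y" "k x" 0] by blast
  then show False using assms(3) by force
qed

text \<open>The coefficients \<open>Lg\<close>, \<open>Mg\<close>, \<open>Ng\<close> of the second fundamental form of the focal surface on the
  axis are compared with the singular curvature \<open>\<kappa>s\<close>, the torsion \<open>\<kappa>t\<close> and the square \<open>\<kappa>c2\<close> of the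
  cuspidal curvature. Its first fundamental form there is diagonal with entries \<open>e\<^sup>2\<close> and \<open>r\<^sup>2\<close>, and
  \<open>k\<close> is the component of the unit normal along a tangent vector of length \<open>e\<close>.\<close>

lemma focal_curvatures_algebra:
  fixes e w N k D M F L r :: real
  assumes "e > 0" "w > 0" "N \<noteq> 0" and k: "k\<^sup>2 = e\<^sup>2" and r: "r = w\<^sup>2 / (e\<^sup>2 * N)"
  defines "Lg \<equiv> k * D / e\<^sup>2" and "Mg \<equiv> r * (k * (F * L - e\<^sup>2 * M) / (w * e\<^sup>2))"
    and "Ng \<equiv> - (k * w / e\<^sup>2)"
    and "\<kappa>s \<equiv> D / e ^ 3" and "\<kappa>t \<equiv> M / w - L * F / (e\<^sup>2 * w)" and "\<kappa>c2 \<equiv> 4 * e ^ 3 * N\<^sup>2 / w ^ 3"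
  shows "(Lg * Ng - Mg\<^sup>2) / (e\<^sup>2 * r\<^sup>2) = - (1/4) * (4 * \<kappa>t\<^sup>2 + \<kappa>s * \<kappa>c2)"
    and "(e\<^sup>2 * Ng + r\<^sup>2 * Lg) / (2 * (e\<^sup>2 * r\<^sup>2)) = - (k / e) * (1/8) * (\<kappa>c2 - 4 * \<kappa>s)"
proof -
  have r0: "r \<noteq> 0" using assms by simp
  have "Lg * Ng - Mg\<^sup>2 = - (k\<^sup>2) * (D * w / e ^ 4) - r\<^sup>2 * k\<^sup>2 * ((F * L - e\<^sup>2 * M) / (w * e\<^sup>2))\<^sup>2"
    using assms(1,2) by (simp add: Lg_def Mg_def Ng_def field_simps power2_eq_square eval_nat_numeral)
  also have "\<dots> = - e\<^sup>2 * (D * w / e ^ 4) - r\<^sup>2 * e\<^sup>2 * \<kappa>t\<^sup>2"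
  proof -
    have "(F * L - e\<^sup>2 * M) / (w * e\<^sup>2) = - \<kappa>t"
      using assms(1,2) by (simp add: \<kappa>t_def field_simps)
    then show ?thesis unfolding k by simp
  qed
  also have "\<dots> = (e\<^sup>2 * r\<^sup>2) * (- (D * w / (e ^ 4 * r\<^sup>2)) - \<kappa>t\<^sup>2)"
    using assms(1) r0 by (simp add: field_simps eval_nat_numeral)
  finally have "(Lg * Ng - Mg\<^sup>2) / (e\<^sup>2 * r\<^sup>2) = - (D * w / (e ^ 4 * r\<^sup>2)) - \<kappa>t\<^sup>2"
    using assms(1) r0 by simp
  also have "D * w / (e ^ 4 * r\<^sup>2) = \<kappa>s * \<kappa>c2 / 4"
    using assms(1-3) by (simp add: r \<kappa>s_def \<kappa>c2_def field_simps eval_nat_numeral)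
  finally show "(Lg * Ng - Mg\<^sup>2) / (e\<^sup>2 * r\<^sup>2) = - (1/4) * (4 * \<kappa>t\<^sup>2 + \<kappa>s * \<kappa>c2)"
    by (simp add: field_simps)
  show "(e\<^sup>2 * Ng + r\<^sup>2 * Lg) / (2 * (e\<^sup>2 * r\<^sup>2)) = - (k / e) * (1/8) * (\<kappa>c2 - 4 * \<kappa>s)"
    using assms(1-3) by (simp add: r Ng_def Lg_def \<kappa>s_def \<kappa>c2_def field_simps eval_nat_numeral)
qed

section \<open>Displacement along a vector field\<close>

lemma
  fixes f \<nu> :: "'a::real_normed_vector \<Rightarrow> 'b::real_normed_vector"
  assumes S: "open S" "x \<in> S" and f: "smooth_on S f" and \<rho>: "smooth_on S \<rho>" and \<nu>: "smooth_on S \<nu>"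
    and g: "smooth_on S g" "\<And>y. y \<in> S \<Longrightarrow> g y = f y + \<rho> y *\<^sub>R \<nu> y"
  shows dir_deriv_displacement:
      "dir_deriv d g x = dir_deriv d f x + (\<rho> x *\<^sub>R dir_deriv d \<nu> x + dir_deriv d \<rho> x *\<^sub>R \<nu> x)"
    and dir_deriv_dir_deriv_displacement:
      "dir_deriv e (dir_deriv d g) x = dir_deriv e (dir_deriv d f) x
         + ((\<rho> x *\<^sub>R dir_deriv e (dir_deriv d \<nu>) x + dir_deriv e \<rho> x *\<^sub>R dir_deriv d \<nu> x)
         + (dir_deriv d \<rho> x *\<^sub>R dir_deriv e \<nu> x + dir_deriv e (dir_deriv d \<rho>) x *\<^sub>R \<nu> x))"
proof -
  have first: "dir_deriv d g y
      = dir_deriv d f y + (\<rho> y *\<^sub>R dir_deriv d \<nu> y + dir_deriv d \<rho> y *\<^sub>R \<nu> y)" if y: "y \<in> S" for y d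
  proof -
    have "dir_deriv d g y = dir_deriv d (\<lambda>y. f y + \<rho> y *\<^sub>R \<nu> y) y"
      using S(1) y g by (intro dir_deriv_cong[of S] smooth_on_differentiable[of S]) auto
    also have "\<dots> = dir_deriv d f y + dir_deriv d (\<lambda>y. \<rho> y *\<^sub>R \<nu> y) y"
      by (rule dir_deriv_add[OF f smooth_on_scaleR[OF S(1) \<rho> \<nu>] y])
    finally show ?thesis
      by (simp add: dir_deriv_scaleR[OF \<rho> \<nu> y])
  qed
  show "dir_deriv d g x = dir_deriv d f x + (\<rho> x *\<^sub>R dir_deriv d \<nu> x + dir_deriv d \<rho> x *\<^sub>R \<nu> x)"
    by (rule first[OF S(2)])
  note sm = smooth_on_dir_deriv[OF f, of d] smooth_on_dir_deriv[OF \<rho>, of d] smooth_on_dir_deriv[OF \<nu>, of d]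
    smooth_on_scaleR[OF S(1) \<rho> smooth_on_dir_deriv[OF \<nu>, of d]]
    smooth_on_scaleR[OF S(1) smooth_on_dir_deriv[OF \<rho>, of d] \<nu>]
  have "dir_deriv e (dir_deriv d g) x
      = dir_deriv e (\<lambda>y. dir_deriv d f y + (\<rho> y *\<^sub>R dir_deriv d \<nu> y + dir_deriv d \<rho> y *\<^sub>R \<nu> y)) x"
    using S first g(1)
    by (intro dir_deriv_cong[of S] smooth_on_differentiable[of S] smooth_on_dir_deriv) auto
  also have "\<dots> = dir_deriv e (dir_deriv d f) x
      + (dir_deriv e (\<lambda>y. \<rho> y *\<^sub>R dir_deriv d \<nu> y) x + dir_deriv e (\<lambda>y. dir_deriv d \<rho> y *\<^sub>R \<nu> y) x)"
    by (subst dir_deriv_add[OF sm(1) smooth_on_add[OF S(1) sm(4,5)] S(2)])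
       (simp add: dir_deriv_add[OF sm(4,5) S(2)])
  also have "dir_deriv e (\<lambda>y. \<rho> y *\<^sub>R dir_deriv d \<nu> y) x
      = \<rho> x *\<^sub>R dir_deriv e (dir_deriv d \<nu>) x + dir_deriv e \<rho> x *\<^sub>R dir_deriv d \<nu> x"
    by (rule dir_deriv_scaleR[OF \<rho> sm(3) S(2)])
  also have "dir_deriv e (\<lambda>y. dir_deriv d \<rho> y *\<^sub>R \<nu> y) x
      = dir_deriv d \<rho> x *\<^sub>R dir_deriv e \<nu> x + dir_deriv e (dir_deriv d \<rho>) x *\<^sub>R \<nu> x"
    by (rule dir_deriv_scaleR[OF sm(2) \<nu> S(2)])
  finally show "dir_deriv e (dir_deriv d g) x = dir_deriv e (dir_deriv d f) x
         + ((\<rho> x *\<^sub>R dir_deriv e (dir_deriv d \<nu>) x + dir_deriv e \<rho> x *\<^sub>R dir_deriv d \<nu> x)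
         + (dir_deriv d \<rho> x *\<^sub>R dir_deriv e \<nu> x + dir_deriv e (dir_deriv d \<rho>) x *\<^sub>R \<nu> x))" .
qed

lemma dir_deriv_vertical_factor:
  fixes F :: "real^2 \<Rightarrow> 'b::real_normed_vector"
  assumes "smooth_on S F" "x \<in> S"
  shows "pdu (\<lambda>y. y$2 *\<^sub>R F y) x = x$2 *\<^sub>R pdu F x"
    and "pdv (\<lambda>y. y$2 *\<^sub>R F y) x = x$2 *\<^sub>R pdv F x + F x"
  using dir_deriv_scaleR[OF smooth_on_component assms]
  by (simp_all add: pdu_eq_dir_deriv pdv_eq_dir_deriv dir_deriv_component axis_def)

section \<open>Fronts in adapted coordinates\<close>

text \<open>The coordinate expression of a front: \<open>f\<close> and \<open>\<nu>\<close> are already composed with the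
  parametrization. On the axis \<open>pdv f\<close> vanishes, so there the immersion condition on \<open>(f, \<nu>)\<close> forces
  \<open>pdv \<nu>\<close> to be nonzero.\<close>

locale adapted_front =
  fixes U :: "(real^2) set" and f \<nu> h :: "real^2 \<Rightarrow> real^3"
  assumes open_U: "open U"
    and smooth_f: "smooth_on U f" and smooth_\<nu>: "smooth_on U \<nu>" and smooth_h: "smooth_on U h"
    and norm_\<nu>: "x \<in> U \<Longrightarrow> norm (\<nu> x) = 1"
    and pdu_\<nu>: "x \<in> U \<Longrightarrow> pdu f x \<bullet> \<nu> x = 0"
    and pdv_\<nu>: "x \<in> U \<Longrightarrow> pdv f x \<bullet> \<nu> x = 0"
    and pdv_f: "x \<in> U \<Longrightarrow> pdv f x = x$2 *\<^sub>R h x"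
    and pdv_area_pos: "x \<in> U \<Longrightarrow> x$2 = 0 \<Longrightarrow> pdv (area_density f \<nu>) x > 0"
    and pdv_\<nu>_nonzero: "x \<in> U \<Longrightarrow> x$2 = 0 \<Longrightarrow> pdv \<nu> x \<noteq> 0"
begin

text \<open>The quotient of the area density by \<open>x$2\<close>, extended smoothly across the axis; where it is
  positive it is the norm of \<open>cross3 (pdu f x) (h x)\<close>.\<close>

definition area_factor :: "real^2 \<Rightarrow> real" where
  "area_factor x = cross3 (pdu f x) (h x) \<bullet> \<nu> x"

lemma smooth_partials:
  "smooth_on U (pdu f)" "smooth_on U (pdv f)" "smooth_on U (pdu \<nu>)" "smooth_on U (pdv \<nu>)"
  "smooth_on U (pdu h)" "smooth_on U (pdv h)"
  by (simp_all add: pdu_eq_dir_deriv pdv_eq_dir_deriv smooth_on_dir_deriv smooth_f smooth_\<nu> smooth_h)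

lemma smooth_area_factor: "smooth_on U area_factor"
  unfolding area_factor_def
  by (intro smooth_on_inner smooth_on_cross3 smooth_partials smooth_h smooth_\<nu> open_U)

lemma \<nu>_\<nu>: "x \<in> U \<Longrightarrow> \<nu> x \<bullet> \<nu> x = 1"
  using norm_\<nu> by (simp add: dot_square_norm)

lemma area_density_eq: "x \<in> U \<Longrightarrow> area_density f \<nu> x = x$2 * area_factor x"
  by (simp add: area_density_def area_factor_def det3_eq_cross_inner pdv_f cross_mult_right)

lemma pd_cong:
  assumes "x \<in> U" "\<And>y. y \<in> U \<Longrightarrow> F y = G y" "smooth_on U F"
  shows "pdu F x = pdu G x" "pdv F x = pdv G x"
  unfolding pdu_eq_dir_deriv pdv_eq_dir_deriv
  using assms open_U by (auto intro!: dir_deriv_cong[of U] smooth_on_differentiable[of U])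

lemma area_factor_pos: 
  assumes "x \<in> U" "x$2 = 0"
  shows "area_factor x > 0"
proof -
  have "smooth_on U (\<lambda>y. y$2 *\<^sub>R area_factor y)"
    by (intro smooth_on_scaleR smooth_on_component smooth_area_factor open_U)
  from pd_cong(2)[OF assms(1) _ this, of "area_density f \<nu>"]
  have "pdv (area_density f \<nu>) x = pdv (\<lambda>y. y$2 *\<^sub>R area_factor y) x"
    by (simp add: area_density_eq)
  then show ?thesis
    using dir_deriv_vertical_factor(2)[OF smooth_area_factor assms(1)] assms(2)
      pdv_area_pos[OF assms] by simp
qed

text \<open>The function \<open>x$2 * (h x \<bullet> \<nu> x)\<close> vanishes identically. Off the axis one divides by \<open>x$2\<close>; on
  the axis the derivative in the direction of \<open>v\<close> leaves \<open>h x \<bullet> \<nu> x\<close>.\<close>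

lemma h_\<nu>: assumes "x \<in> U" shows "h x \<bullet> \<nu> x = 0"
proof -
  have sm: "smooth_on U (\<lambda>y. h y \<bullet> \<nu> y)"
    by (intro smooth_on_inner smooth_h smooth_\<nu> open_U)
  have 0: "y$2 *\<^sub>R (h y \<bullet> \<nu> y) = 0" if "y \<in> U" for y
    using pdv_\<nu>[OF that] pdv_f[OF that] by simp
  have "pdv (\<lambda>y. y$2 *\<^sub>R (h y \<bullet> \<nu> y)) x = pdv (\<lambda>y. 0 :: real) x"
    using 0 by (intro pd_cong(2)[OF assms] smooth_on_scaleR smooth_on_component sm open_U)
  then have "x$2 *\<^sub>R pdv (\<lambda>y. h y \<bullet> \<nu> y) x + h x \<bullet> \<nu> x = 0"
    using dir_deriv_vertical_factor(2)[OF sm assms] by (simp add: pdv_eq_dir_deriv dir_deriv_const)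
  then show ?thesis using 0[OF assms] by auto
qed

text \<open>Differentiating a constant inner product moves the derivative from one factor to the
  other.\<close>

lemma inner_const_derivative:
  assumes "smooth_on U F" "smooth_on U G" "\<And>y. y \<in> U \<Longrightarrow> F y \<bullet> G y = c" "x \<in> U"
  shows "pdu F x \<bullet> G x = - (F x \<bullet> pdu G x)" "pdv F x \<bullet> G x = - (F x \<bullet> pdv G x)"
proof -
  have "dir_deriv e (\<lambda>y. F y \<bullet> G y) x = dir_deriv e (\<lambda>y. c) x" for e
    using assms open_U by (intro dir_deriv_cong[of U] smooth_on_differentiable[of U] smooth_on_inner) auto
  then have "F x \<bullet> dir_deriv e G x + dir_deriv e F x \<bullet> G x = 0" for e
    by (simp add: dir_deriv_const dir_deriv_inner[OF assms(1,2,4)])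
  then show "pdu F x \<bullet> G x = - (F x \<bullet> pdu G x)" "pdv F x \<bullet> G x = - (F x \<bullet> pdv G x)"
    unfolding pdu_eq_dir_deriv pdv_eq_dir_deriv by (simp_all add: eq_neg_iff_add_eq_0 add.commute)
qed

lemma partials_\<nu>_\<nu>: "x \<in> U \<Longrightarrow> pdu \<nu> x \<bullet> \<nu> x = 0" "x \<in> U \<Longrightarrow> pdv \<nu> x \<bullet> \<nu> x = 0"
  using inner_const_derivative[OF smooth_\<nu> smooth_\<nu> \<nu>_\<nu>] by (simp_all add: inner_commute)

lemma tL_eq: "x \<in> U \<Longrightarrow> tL f \<nu> x = pdu (pdu f) x \<bullet> \<nu> x"
  using inner_const_derivative(1)[OF smooth_partials(1) smooth_\<nu> pdu_\<nu>] by (simp add: tL_def)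

lemma tM_eq: "x \<in> U \<Longrightarrow> tM h \<nu> x = pdu h x \<bullet> \<nu> x"
  using inner_const_derivative(1)[OF smooth_h smooth_\<nu> h_\<nu>] by (simp add: tM_def)

lemma tN_eq: "x \<in> U \<Longrightarrow> tN h \<nu> x = pdv h x \<bullet> \<nu> x"
  using inner_const_derivative(2)[OF smooth_h smooth_\<nu> h_\<nu>] by (simp add: tN_def)

lemma smooth_vertical_factor:
  "smooth_on U F \<Longrightarrow> smooth_on U (\<lambda>y. y$2 *\<^sub>R F y)"
  by (intro smooth_on_scaleR smooth_on_component open_U)

lemma pdu_pdv_f: "x \<in> U \<Longrightarrow> pdu (pdv f) x = x$2 *\<^sub>R pdu h x"
  and pdv_pdv_f: "x \<in> U \<Longrightarrow> pdv (pdv f) x = x$2 *\<^sub>R pdv h x + h x"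
  using pd_cong[OF _ pdv_f smooth_partials(2)] dir_deriv_vertical_factor[OF smooth_h] by simp_all

text \<open>Symmetry of the mixed derivatives shows that this one vanishes on the axis together with
  \<open>pdu (pdv f)\<close>.\<close>

lemma pdv_pdu_f: "x \<in> U \<Longrightarrow> pdv (pdu f) x = x$2 *\<^sub>R pdu h x"
  using pdu_pdv_f mixed_derivatives_commute[OF open_U smooth_f]
  unfolding pdu_eq_dir_deriv pdv_eq_dir_deriv by metis

lemma axis_third_derivatives:
  assumes "x \<in> U" "x$2 = 0"
  shows "pdv (pdv (pdu f)) x = pdu h x" "pdv (pdv (pdv f)) x = 2 *\<^sub>R pdv h x"
proof -
  have sm: "smooth_on U (pdv (pdu f))" "smooth_on U (pdv (pdv f))"
    using smooth_partials by (simp_all add: pdv_eq_dir_deriv smooth_on_dir_deriv)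
  show "pdv (pdv (pdu f)) x = pdu h x"
    using pd_cong(2)[OF assms(1) pdv_pdu_f sm(1)]
      dir_deriv_vertical_factor(2)[OF smooth_partials(5) assms(1)] assms by simp
  have "pdv (\<lambda>y. y$2 *\<^sub>R pdv h y + h y) x = pdv (\<lambda>y. y$2 *\<^sub>R pdv h y) x + pdv h x"
    unfolding pdv_eq_dir_deriv
    by (rule dir_deriv_add[OF smooth_vertical_factor[OF smooth_on_dir_deriv[OF smooth_h]] smooth_h assms(1)])
  then show "pdv (pdv (pdv f)) x = 2 *\<^sub>R pdv h x"
    using pd_cong(2)[OF assms(1) pdv_pdv_f sm(2)]
      dir_deriv_vertical_factor(2)[OF smooth_partials(6) assms(1)] assms
    by (simp add: scaleR_2)
qed

lemma pdu_f_pdv_\<nu>: assumes "x \<in> U" "x$2 = 0" shows "pdu f x \<bullet> pdv \<nu> x = 0"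
  using inner_const_derivative(2)[OF smooth_partials(1) smooth_\<nu> pdu_\<nu> assms(1)]
    pdv_pdu_f[OF assms(1)] assms(2) by simp

lemma cross_pdu_h: "x \<in> U \<Longrightarrow> cross3 (pdu f x) (h x) = area_factor x *\<^sub>R \<nu> x"
  unfolding area_factor_def using cross3_tangent_vectors[OF \<nu>_\<nu> pdu_\<nu> h_\<nu>] by blast

lemma pdu_f_nonzero: "x \<in> U \<Longrightarrow> area_factor x \<noteq> 0 \<Longrightarrow> pdu f x \<noteq> 0"
  by (auto simp: area_factor_def)

text \<open>On the axis \<open>pdv \<nu> x\<close> is a nonzero vector orthogonal to \<open>\<nu> x\<close> and to \<open>pdu f x\<close>. It is therefore
  parallel to \<open>cross3 (\<nu> x) (pdu f x)\<close>, along which \<open>h x\<close> has the nonzero component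
  \<open>area_factor x\<close>.\<close>

lemma tN_nonzero: assumes x: "x \<in> U" "x$2 = 0" shows "tN h \<nu> x \<noteq> 0"
proof
  let ?a = "pdu f x" and ?c = "cross3 (\<nu> x) (pdu f x)"
  assume "tN h \<nu> x = 0"
  then have "h x \<bullet> pdv \<nu> x = 0" by (simp add: tN_def)
  then have "(h x \<bullet> ?c) * (pdv \<nu> x \<bullet> ?c) = 0"
    using inner_tangent_expand[OF \<nu>_\<nu> pdu_\<nu> h_\<nu>, OF x(1) x(1) x(1), of "pdv \<nu> x"] pdu_f_pdv_\<nu>[OF x]
    by (simp add: inner_commute)
  moreover have "h x \<bullet> ?c = area_factor x"
    by (simp add: area_factor_def cross3_inner_rotate)
  ultimately have "pdv \<nu> x \<bullet> ?c = 0"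
    using area_factor_pos[OF x] by simp
  then have "(?a \<bullet> ?a) * (pdv \<nu> x \<bullet> pdv \<nu> x) = 0"
    using inner_tangent_expand[OF \<nu>_\<nu> pdu_\<nu> partials_\<nu>_\<nu>(2), OF x(1) x(1) x(1), of "pdv \<nu> x"] pdu_f_pdv_\<nu>[OF x]
    by (simp add: inner_commute)
  then show False
    using pdv_\<nu>_nonzero[OF x] pdu_f_nonzero[of x] area_factor_pos[OF x] x by simp
qed

end

section \<open>The focal surface near the singular curve\<close>

context adapted_front
begin

definition discriminant :: "real^2 \<Rightarrow> real" where
  "discriminant x = (tA f \<nu> h x)\<^sup>2 -
     4 * x$2 * (tE f x * tG h x - (tF f h x)\<^sup>2) * (tL f \<nu> x * tN h \<nu> x - x$2 * (tM h \<nu> x)\<^sup>2)"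

lemma tAB_eq: "tAB f \<nu> h x = tA f \<nu> h x + sgn (tN h \<nu> 0) * sqrt (discriminant x)"
  by (simp add: tAB_def tB_def discriminant_def)

lemma smooth_fundamental_coefficients:
  "smooth_on U (tE f)" "smooth_on U (tF f h)" "smooth_on U (tG h)"
  "smooth_on U (tL f \<nu>)" "smooth_on U (tM h \<nu>)" "smooth_on U (tN h \<nu>)"
  unfolding tE_def tF_def tG_def tL_def tM_def tN_def power2_norm_eq_inner
  by (intro smooth_on_inner smooth_on_minus smooth_partials smooth_h open_U)+

lemma smooth_tA: "smooth_on U (tA f \<nu> h)"
  unfolding tA_def
  by (intro smooth_on_add smooth_on_diff smooth_on_mult smooth_fundamental_coefficients
      smooth_on_const smooth_on_component open_U)

lemma smooth_discriminant: "smooth_on U discriminant"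
  unfolding discriminant_def power2_eq_square
  by (intro smooth_on_diff smooth_on_mult smooth_fundamental_coefficients smooth_tA
      smooth_on_const smooth_on_component open_U)

text \<open>The open set on which the focal surface is given by a smooth formula: the square root is taken
  of a positive number, the denominator \<open>tAB\<close> does not vanish, and \<open>tN\<close> keeps the sign that it has at
  the origin.\<close>

definition regular_part :: "(real^2) set" where
  "regular_part = {x\<in>U. area_factor x > 0} \<inter> {x\<in>U. tN h \<nu> x * tN h \<nu> 0 > 0}
     \<inter> {x\<in>U. discriminant x > 0} \<inter> {x\<in>U. \<bar>tAB f \<nu> h x\<bar> > 0}"

lemma open_positivity_set: "continuous_on U F \<Longrightarrow> open {x\<in>U. F x > (0::real)}"
  using continuous_open_preimage[OF _ open_U, of F "{0<..}"]
  by (simp add: vimage_def Int_def)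

lemma open_regular_part: "open regular_part"
proof -
  have "continuous_on U (tAB f \<nu> h)"
    unfolding tAB_eq
    by (intro continuous_on_add continuous_on_mult continuous_on_const continuous_on_real_sqrt
        smooth_on_imp_continuous_on smooth_tA smooth_discriminant)
  moreover have "continuous_on U (\<lambda>x. tN h \<nu> x * tN h \<nu> 0)"
    by (intro continuous_on_mult continuous_on_const smooth_on_imp_continuous_on
        smooth_fundamental_coefficients)
  ultimately show ?thesis
    unfolding regular_part_def
    by (intro open_Int open_positivity_set continuous_on_rabs
        smooth_on_imp_continuous_on[OF smooth_area_factor]
        smooth_on_imp_continuous_on[OF smooth_discriminant])
qed

lemma regular_part_subset: "regular_part \<subseteq> U"
  by (auto simp: regular_part_def)

lemma regular_partD:
  assumes "x \<in> regular_part"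
  shows "x \<in> U" "area_factor x > 0" "discriminant x > 0" "tAB f \<nu> h x \<noteq> 0"
  using assms by (auto simp: regular_part_def)

text \<open>On the axis the square root is the absolute value of \<open>tA\<close>, and the sign in front of it is that
  of \<open>tA\<close>: the two terms of \<open>tAB\<close> agree instead of cancelling.\<close>

lemma axis_tAB:
  assumes "x$2 = 0" "tN h \<nu> x * tN h \<nu> 0 > 0"
  shows "discriminant x = (tE f x * tN h \<nu> x)\<^sup>2" "tAB f \<nu> h x = 2 * (tE f x * tN h \<nu> x)"
proof -
  show d: "discriminant x = (tE f x * tN h \<nu> x)\<^sup>2"
    using assms(1) by (simp add: discriminant_def tA_def)
  have "sgn (tN h \<nu> 0) * \<bar>tN h \<nu> x\<bar> = tN h \<nu> x"
    using assms(2) by (auto simp: zero_less_mult_iff)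
  then have "sgn (tN h \<nu> 0) * \<bar>tE f x * tN h \<nu> x\<bar> = tE f x * tN h \<nu> x"
    by (simp add: abs_mult tE_def algebra_simps)
  then show "tAB f \<nu> h x = 2 * (tE f x * tN h \<nu> x)"
    using assms(1) by (simp add: tAB_eq d tA_def)
qed

lemma tE_pos: "x \<in> U \<Longrightarrow> area_factor x \<noteq> 0 \<Longrightarrow> tE f x > 0"
  using pdu_f_nonzero by (simp add: tE_def)

lemma zero_in_regular_part:
  assumes "0 \<in> U"
  shows "0 \<in> regular_part"
proof -
  have "area_factor 0 > 0" "tN h \<nu> 0 \<noteq> 0"
    using area_factor_pos[OF assms] tN_nonzero[OF assms] by simp_all
  moreover from this have "tN h \<nu> 0 * tN h \<nu> 0 > 0" "tE f 0 > 0"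
    using tE_pos[OF assms] by (auto simp: zero_less_mult_iff)
  ultimately show ?thesis
    using assms axis_tAB[of 0] by (auto simp: regular_part_def zero_less_mult_iff)
qed

text \<open>The factor \<open>r\<close> in the displacement \<open>v r \<nu>\<close> from \<open>f\<close> to its focal surface.\<close>

definition focal_factor :: "real^2 \<Rightarrow> real" where
  "focal_factor x = 2 * (area_factor x)\<^sup>2 / tAB f \<nu> h x"

lemma focal_surface_eq:
  assumes "x \<in> regular_part"
  shows "focal_surface f \<nu> h x = f x + (x$2 *\<^sub>R focal_factor x) *\<^sub>R \<nu> x"
proof -
  note x = regular_partD[OF assms]
  have "norm (cross3 (pdu f x) (h x)) = area_factor x"
    using x by (simp add: cross_pdu_h norm_\<nu>)
  then show ?thesis
    using x by (simp add: focal_surface_def hat_curvature_def area_density_eq focal_factor_def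
        power2_eq_square field_simps)
qed

lemma smooth_focal_factor: "smooth_on regular_part focal_factor"
proof -
  note sub = smooth_on_subset[OF _ regular_part_subset]
  have "smooth_on regular_part (tAB f \<nu> h)"
    unfolding tAB_eq
    by (intro smooth_on_add smooth_on_mult smooth_on_const smooth_on_sqrt sub[OF smooth_tA]
        sub[OF smooth_discriminant] open_regular_part regular_partD(3))
  then show ?thesis
    unfolding focal_factor_def power2_eq_square
    by (intro smooth_on_divide smooth_on_mult smooth_on_const sub[OF smooth_area_factor]
        open_regular_part regular_partD(4))
qed

lemma axis_focal_factor:
  assumes "x \<in> regular_part" "x$2 = 0"
  shows "focal_factor x = (area_factor x)\<^sup>2 / (tE f x * tN h \<nu> x)"
  using assms axis_tAB(2)[of x] by (simp add: focal_factor_def regular_part_def)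

lemma smooth_displacement: "smooth_on regular_part (\<lambda>x. x$2 *\<^sub>R focal_factor x)"
  by (intro smooth_on_scaleR smooth_on_component smooth_focal_factor open_regular_part)

lemma smooth_focal_surface: "smooth_on regular_part (focal_surface f \<nu> h)"
proof (rule smooth_on_cong[OF open_regular_part])
  show "smooth_on regular_part (\<lambda>x. f x + (x$2 *\<^sub>R focal_factor x) *\<^sub>R \<nu> x)"
    by (intro smooth_on_add smooth_on_scaleR[OF _ smooth_displacement] open_regular_part
        smooth_on_subset[OF smooth_f regular_part_subset] smooth_on_subset[OF smooth_\<nu> regular_part_subset])
qed (simp add: focal_surface_eq)

text \<open>The displacement \<open>x$2 * focal_factor x\<close> and its derivative along the axis vanish on the axis, and
  its second derivatives multiply \<open>\<nu> x\<close>, which is orthogonal to \<open>n\<close>. Only the value of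
  \<open>focal_factor\<close> survives.\<close>

lemma axis_focal_derivatives:
  assumes x: "x \<in> regular_part" "x$2 = 0"
  shows axis_focal_pdu: "pdu (focal_surface f \<nu> h) x = pdu f x"
    and axis_focal_pdv: "pdv (focal_surface f \<nu> h) x = focal_factor x *\<^sub>R \<nu> x"
    and "n \<bullet> \<nu> x = 0 \<Longrightarrow> pdu (pdu (focal_surface f \<nu> h)) x \<bullet> n = pdu (pdu f) x \<bullet> n"
    and "n \<bullet> \<nu> x = 0 \<Longrightarrow> pdv (pdu (focal_surface f \<nu> h)) x \<bullet> n = focal_factor x * (pdu \<nu> x \<bullet> n)"
    and "n \<bullet> \<nu> x = 0 \<Longrightarrow>
      pdv (pdv (focal_surface f \<nu> h)) x \<bullet> n = h x \<bullet> n + 2 * focal_factor x * (pdv \<nu> x \<bullet> n)"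
proof -
  let ?\<rho> = "\<lambda>x. x$2 *\<^sub>R focal_factor x"
  have U: "x \<in> U" using regular_partD(1)[OF x(1)] .
  have \<rho>: "dir_deriv (axis 1 1) ?\<rho> x = 0" "dir_deriv (axis 2 1) ?\<rho> x = focal_factor x"
    using dir_deriv_vertical_factor[OF smooth_focal_factor x(1)] x(2)
    by (simp_all add: pdu_eq_dir_deriv pdv_eq_dir_deriv)
  note sub = smooth_on_subset[OF _ regular_part_subset]
  have first: "dir_deriv d (focal_surface f \<nu> h) x
      = dir_deriv d f x + (?\<rho> x *\<^sub>R dir_deriv d \<nu> x + dir_deriv d ?\<rho> x *\<^sub>R \<nu> x)" for d
    by (rule dir_deriv_displacement[OF open_regular_part x(1) sub[OF smooth_f] smooth_displacement
          sub[OF smooth_\<nu>] smooth_focal_surface focal_surface_eq])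
  have second: "dir_deriv e (dir_deriv d (focal_surface f \<nu> h)) x = dir_deriv e (dir_deriv d f) x
      + ((?\<rho> x *\<^sub>R dir_deriv e (dir_deriv d \<nu>) x + dir_deriv e ?\<rho> x *\<^sub>R dir_deriv d \<nu> x)
      + (dir_deriv d ?\<rho> x *\<^sub>R dir_deriv e \<nu> x + dir_deriv e (dir_deriv d ?\<rho>) x *\<^sub>R \<nu> x))" for d e
    by (rule dir_deriv_dir_deriv_displacement[OF open_regular_part x(1) sub[OF smooth_f]
          smooth_displacement sub[OF smooth_\<nu>] smooth_focal_surface focal_surface_eq])
  have f: "dir_deriv (axis 2 1) f x = 0" "dir_deriv (axis 2 1) (dir_deriv (axis 1 1) f) x = 0"
    "dir_deriv (axis 2 1) (dir_deriv (axis 2 1) f) x = h x"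
    using pdv_f[OF U] pdv_pdu_f[OF U] pdv_pdv_f[OF U] x(2)
    by (simp_all add: pdu_eq_dir_deriv pdv_eq_dir_deriv)
  show "pdu (focal_surface f \<nu> h) x = pdu f x" "pdv (focal_surface f \<nu> h) x = focal_factor x *\<^sub>R \<nu> x"
    unfolding pdu_eq_dir_deriv pdv_eq_dir_deriv first \<rho> f x(2) by simp_all
  assume "n \<bullet> \<nu> x = 0"
  then have n: "\<nu> x \<bullet> n = 0" by (simp add: inner_commute)
  show "pdu (pdu (focal_surface f \<nu> h)) x \<bullet> n = pdu (pdu f) x \<bullet> n"
    "pdv (pdu (focal_surface f \<nu> h)) x \<bullet> n = focal_factor x * (pdu \<nu> x \<bullet> n)"
    "pdv (pdv (focal_surface f \<nu> h)) x \<bullet> n = h x \<bullet> n + 2 * focal_factor x * (pdv \<nu> x \<bullet> n)"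
    unfolding pdu_eq_dir_deriv pdv_eq_dir_deriv second \<rho> f x(2)
    by (simp_all only: inner_add_left inner_scaleR_left n) simp_all
qed

text \<open>On the axis the higher derivatives of \<open>f\<close> in the definitions reduce to first derivatives of
  \<open>h\<close>, and \<open>pdu f x \<times> h x\<close> is a multiple of \<open>\<nu> x\<close>. The determinants in the torsion and in
  the cuspidal curvature thus become inner products with \<open>\<nu> x\<close>, which are the coefficients \<open>tL\<close>, \<open>tM\<close> and \<open>tN\<close>.\<close>

lemma axis_invariants:
  assumes x: "x \<in> U" "x$2 = 0"
  defines "e \<equiv> norm (pdu f x)" and "w \<equiv> area_factor x"
  shows "singular_curvature f \<nu> x = (pdu (pdu f) x \<bullet> cross3 (\<nu> x) (pdu f x)) / e ^ 3"
    and "(cuspidal_curvature f x)\<^sup>2 = 4 * e ^ 3 * (tN h \<nu> x)\<^sup>2 / w ^ 3"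
    and "cusp_directional_torsion f x = tM h \<nu> x / w - tL f \<nu> x * tF f h x / (e\<^sup>2 * w)"
proof -
  have w: "w > 0" using area_factor_pos[OF x] by (simp add: w_def)
  have cross: "cross3 (pdu f x) (h x) = w *\<^sub>R \<nu> x" "norm (cross3 (pdu f x) (h x)) = w"
    using cross_pdu_h[OF x(1)] w norm_\<nu>[OF x(1)] by (simp_all add: w_def)
  have fvv: "pdv (pdv f) x = h x"
    using pdv_pdv_f[OF x(1)] x(2) by simp
  have e: "e > 0"
    using pdu_f_nonzero[OF x(1)] w by (simp add: e_def w_def)
  show "singular_curvature f \<nu> x = (pdu (pdu f) x \<bullet> cross3 (\<nu> x) (pdu f x)) / e ^ 3"
    using pdv_area_pos[OF x]
    by (simp add: singular_curvature_def det3_eq_cross_inner cross3_inner_rotate e_def)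
  have "cuspidal_curvature f x = e powr (3/2) * (2 * w * tN h \<nu> x) / w powr (5/2)"
    by (simp add: cuspidal_curvature_def fvv axis_third_derivatives(2)[OF x] det3_eq_cross_inner
        cross norm_\<nu>[OF x(1)] abs_of_pos[OF w] tN_eq[OF x(1)] inner_commute e_def)
  moreover have "(e powr (3/2))\<^sup>2 = e ^ 3" "(w powr (5/2))\<^sup>2 = w ^ 5"
    using e w by (simp_all add: powr_power powr_numeral)
  ultimately have "(cuspidal_curvature f x)\<^sup>2 = e ^ 3 * (2 * w * tN h \<nu> x)\<^sup>2 / w ^ 5"
    by (simp add: power_divide power_mult_distrib)
  then show "(cuspidal_curvature f x)\<^sup>2 = 4 * e ^ 3 * (tN h \<nu> x)\<^sup>2 / w ^ 3"
    using w by (simp add: field_simps eval_nat_numeral)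
  show "cusp_directional_torsion f x = tM h \<nu> x / w - tL f \<nu> x * tF f h x / (e\<^sup>2 * w)"
    using w e
    by (simp add: cusp_directional_torsion_def fvv axis_third_derivatives(1)[OF x] det3_eq_cross_inner
        cross norm_\<nu>[OF x(1)] tM_eq[OF x(1)] tL_eq[OF x(1)] inner_commute e_def[symmetric] tF_def field_simps power2_eq_square)
qed

text \<open>The normal \<open>n x\<close> and the vector \<open>h x\<close> are expanded in the frame formed by \<open>pdu f x\<close> and
  \<open>cross3 (\<nu> x) (pdu f x)\<close>. The expansion of \<open>h x\<close> is paired with \<open>pdu \<nu> x\<close> and \<open>pdv \<nu> x\<close>, which
  gives the components of these two derivatives along \<open>n x\<close>.\<close>

lemma axis_focal_curvatures:
  assumes x: "x \<in> regular_part" "x$2 = 0"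
    and n: "norm (n x) = 1" "n x \<bullet> pdu f x = 0" "n x \<bullet> \<nu> x = 0"
  defines "k \<equiv> n x \<bullet> cross3 (\<nu> x) (pdu f x)" and "e \<equiv> norm (pdu f x)"
  shows "k\<^sup>2 = e\<^sup>2"
    and "gauss_curvature (focal_surface f \<nu> h) n x = - (1/4) * (4 * (cusp_directional_torsion f x)\<^sup>2
           + singular_curvature f \<nu> x * (cuspidal_curvature f x)\<^sup>2)"
    and "mean_curvature (focal_surface f \<nu> h) n x
           = - (k / e) * (1/8) * ((cuspidal_curvature f x)\<^sup>2 - 4 * singular_curvature f \<nu> x)"
proof -
  note U = regular_partD(1)[OF x(1)]
  let ?a = "pdu f x" and ?c = "cross3 (\<nu> x) (pdu f x)"
  define w N r D where "w = area_factor x" "N = tN h \<nu> x" "r = focal_factor x"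
    "D = pdu (pdu f) x \<bullet> ?c"
  note defs = this
  define F L M where "F = tF f h x" "L = tL f \<nu> x" "M = tM h \<nu> x"
  note defs = defs this
  have w: "w > 0" using area_factor_pos[OF U x(2)] by (simp add: defs)
  have N: "N \<noteq> 0" using tN_nonzero[OF U x(2)] by (simp add: defs)
  have e: "e > 0" using pdu_f_nonzero[OF U] w by (simp add: e_def defs)
  have aa: "?a \<bullet> ?a = e\<^sup>2" by (simp add: e_def power2_norm_eq_inner)
  have r: "r = w\<^sup>2 / (e\<^sup>2 * N)"
    using axis_focal_factor[OF x] by (simp add: defs tE_def e_def)
  have expand_n: "e\<^sup>2 * (n x \<bullet> z) = k * (z \<bullet> ?c)" for z
    using inner_tangent_expand[OF \<nu>_\<nu> pdu_\<nu> n(3), OF U U, of z] n(2) by (simp add: aa k_def)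
  have hc: "h x \<bullet> ?c = w"
    by (simp add: defs area_factor_def cross3_inner_rotate)
  have expand_h: "e\<^sup>2 * (h x \<bullet> z) = F * (z \<bullet> ?a) + w * (z \<bullet> ?c)" for z
    using inner_tangent_expand[OF \<nu>_\<nu> pdu_\<nu> h_\<nu>, OF U U U, of z]
    by (simp add: aa hc defs tF_def inner_commute)
  show k: "k\<^sup>2 = e\<^sup>2"
    using expand_n[of "n x"] n(1) by (simp add: k_def power2_eq_square dot_square_norm)
  have qc: "pdu \<nu> x \<bullet> ?c = (F * L - e\<^sup>2 * M) / w"
    using expand_h[of "pdu \<nu> x"] w by (simp add: defs tM_def tL_def inner_commute field_simps)
  have sc: "pdv \<nu> x \<bullet> ?c = - (e\<^sup>2 * N / w)"
    using expand_h[of "pdv \<nu> x"] w pdu_f_pdv_\<nu>[OF U x(2)]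
    by (simp add: defs tN_def inner_commute field_simps)
  have div: "n x \<bullet> z = k * (z \<bullet> ?c) / e\<^sup>2" for z
    using expand_n[of z] e by (simp add: field_simps)
  have L': "pdu (pdu (focal_surface f \<nu> h)) x \<bullet> n x = k * D / e\<^sup>2"
    using axis_focal_derivatives(3)[OF x n(3)] div[of "pdu (pdu f) x"] by (simp add: inner_commute defs)
  have M': "pdv (pdu (focal_surface f \<nu> h)) x \<bullet> n x = r * (k * (F * L - e\<^sup>2 * M) / (w * e\<^sup>2))"
    using axis_focal_derivatives(4)[OF x n(3)] div[of "pdu \<nu> x"] by (simp add: inner_commute defs(3) qc)
  have "pdv (pdv (focal_surface f \<nu> h)) x \<bullet> n x = k * w / e\<^sup>2 + 2 * r * (k * (- (e\<^sup>2 * N / w)) / e\<^sup>2)"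
    using axis_focal_derivatives(5)[OF x n(3)] div[of "h x"] div[of "pdv \<nu> x"]
    by (simp add: inner_commute defs(3) sc hc)
  \<comment> \<open>By the value of \<open>r\<close> the second term is \<open>- 2\<close> times the first, so the displacement reverses the
    component of \<open>h x\<close>.\<close>
  also have "\<dots> = - (k * w / e\<^sup>2)"
    using w N e by (simp add: r field_simps power2_eq_square)
  finally have N': "pdv (pdv (focal_surface f \<nu> h)) x \<bullet> n x = - (k * w / e\<^sup>2)" .
  note first = axis_focal_pdu[OF x] axis_focal_pdv[OF x]
  have EFG: "pdu (focal_surface f \<nu> h) x \<bullet> pdu (focal_surface f \<nu> h) x = e\<^sup>2"
    "pdu (focal_surface f \<nu> h) x \<bullet> pdv (focal_surface f \<nu> h) x = 0"
    "pdv (focal_surface f \<nu> h) x \<bullet> pdv (focal_surface f \<nu> h) x = r\<^sup>2"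
    using \<nu>_\<nu>[OF U] pdu_\<nu>[OF U] by (simp_all add: first aa defs(3) power2_eq_square)
  note invariants = axis_invariants[OF U x(2)]
  note alg = focal_curvatures_algebra[OF e w N k r]
  show "gauss_curvature (focal_surface f \<nu> h) n x = - (1/4) * (4 * (cusp_directional_torsion f x)\<^sup>2
           + singular_curvature f \<nu> x * (cuspidal_curvature f x)\<^sup>2)"
    unfolding gauss_curvature_def Let_def EFG L' M' N' invariants
    using alg(1)[of D F L M] by (simp add: defs e_def)
  show "mean_curvature (focal_surface f \<nu> h) n x
           = - (k / e) * (1/8) * ((cuspidal_curvature f x)\<^sup>2 - 4 * singular_curvature f \<nu> x)"
    unfolding mean_curvature_def Let_def EFG L' M' N' invariants
    using alg(2)[of D] by (simp add: defs e_def)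
qed

lemma focal_surface_immersion_nbhd:
  assumes "0 \<in> U"
  obtains W where "open W" "convex W" "0 \<in> W" "W \<subseteq> regular_part" "immersion_on W (focal_surface f \<nu> h)"
proof -
  let ?g = "focal_surface f \<nu> h"
  define Q where "Q = {x\<in>regular_part. cross3 (pdu ?g x) (pdv ?g x) \<noteq> 0}"
  have "continuous_on regular_part (\<lambda>x. cross3 (pdu ?g x) (pdv ?g x))"
    unfolding pdu_eq_dir_deriv pdv_eq_dir_deriv
    by (intro smooth_on_imp_continuous_on smooth_on_cross3 smooth_on_dir_deriv smooth_focal_surface
        open_regular_part)
  then have "open Q"
    using continuous_open_preimage[OF _ open_regular_part, of _ "- {0}"]
    by (auto simp: Q_def vimage_def Int_def)
  have 0: "0 \<in> regular_part" by (rule zero_in_regular_part[OF assms])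
  have "0 \<in> Q"
  proof -
    have "pdu f 0 \<noteq> 0" "focal_factor 0 \<noteq> 0"
      using pdu_f_nonzero[OF assms] regular_partD[OF 0] by (auto simp: focal_factor_def)
    moreover have "(norm (cross3 (pdu f 0) (\<nu> 0)))\<^sup>2 = (norm (pdu f 0))\<^sup>2"
      using norm_cross_dot[of "pdu f 0" "\<nu> 0"] pdu_\<nu>[OF assms] norm_\<nu>[OF assms] by simp
    ultimately show ?thesis
      using 0 by (auto simp: Q_def axis_focal_pdu[OF 0] axis_focal_pdv[OF 0] cross_mult_right)
  qed
  obtain \<epsilon> where "\<epsilon> > 0" "ball 0 \<epsilon> \<subseteq> Q"
    using \<open>open Q\<close> \<open>0 \<in> Q\<close> open_contains_ball by blast
  show ?thesis
  proof (rule that[of "ball 0 \<epsilon>"])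
    show sub: "ball 0 \<epsilon> \<subseteq> regular_part"
      using \<open>ball 0 \<epsilon> \<subseteq> Q\<close> by (auto simp: Q_def)
    have "inj (frechet_derivative ?g (at x))" if "x \<in> ball 0 \<epsilon>" for x
    proof (rule linear_inj_if_cross3_nonzero)
      show "linear (frechet_derivative ?g (at x))"
        using sub that smooth_on_differentiable[OF smooth_focal_surface]
        by (intro linear_frechet_derivative) auto
      show "cross3 (frechet_derivative ?g (at x) (axis 1 1)) (frechet_derivative ?g (at x) (axis 2 1)) \<noteq> 0"
        using \<open>ball 0 \<epsilon> \<subseteq> Q\<close> that by (auto simp: Q_def pdu_def pdv_def)
    qed
    then show "immersion_on (ball 0 \<epsilon>) ?g"
      using smooth_on_subset[OF smooth_focal_surface sub] by (simp add: immersion_on_def)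
  qed (use \<open>\<epsilon> > 0\<close> in auto)
qed

text \<open>The pointwise formula for the mean curvature has the sign of \<open>- k\<close>, where \<open>k\<close> is the component of
  the normal along \<open>cross3 (\<nu> x) (pdu f x)\<close>. On the axis \<open>k\<close> has no zeros, and the convexity of \<open>W\<close>
  makes the axis connected inside \<open>W\<close>, so one sign serves for all its points.\<close>

theorem focal_surface_curvatures:
  assumes "0 \<in> U"
  shows "\<exists>W. open W \<and> connected W \<and> 0 \<in> W \<and> W \<subseteq> U \<and> immersion_on W (focal_surface f \<nu> h) \<and>
    (\<forall>n. unit_normal_on W (focal_surface f \<nu> h) n \<longrightarrow>
      (\<forall>x\<in>W. x$2 = 0 \<longrightarrow>
        gauss_curvature (focal_surface f \<nu> h) n x =
          - (1/4) * (4 * (cusp_directional_torsion f x)\<^sup>2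
                     + singular_curvature f \<nu> x * (cuspidal_curvature f x)\<^sup>2)) \<and>
      (\<exists>\<sigma>\<in>{1, -1}. \<forall>x\<in>W. x$2 = 0 \<longrightarrow>
        mean_curvature (focal_surface f \<nu> h) n x =
          \<sigma> * (1/8) * ((cuspidal_curvature f x)\<^sup>2 - 4 * singular_curvature f \<nu> x)))"
proof -
  let ?g = "focal_surface f \<nu> h"
  obtain W where W: "open W" "convex W" "0 \<in> W" "W \<subseteq> regular_part" "immersion_on W ?g"
    using focal_surface_immersion_nbhd[OF assms] .
  have curvatures: "(\<forall>x\<in>W. x$2 = 0 \<longrightarrow> gauss_curvature ?g n x =
          - (1/4) * (4 * (cusp_directional_torsion f x)\<^sup>2
                     + singular_curvature f \<nu> x * (cuspidal_curvature f x)\<^sup>2)) \<and>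
      (\<exists>\<sigma>\<in>{1, -1}. \<forall>x\<in>W. x$2 = 0 \<longrightarrow> mean_curvature ?g n x =
          \<sigma> * (1/8) * ((cuspidal_curvature f x)\<^sup>2 - 4 * singular_curvature f \<nu> x))"
    if n: "unit_normal_on W ?g n" for n
  proof -
    have normal: "norm (n x) = 1" "n x \<bullet> pdu f x = 0" "n x \<bullet> \<nu> x = 0" if "x \<in> W" "x$2 = 0" for x
    proof -
      have x: "x \<in> regular_part" using that W by auto
      have "norm (n x) = 1" "pdu ?g x \<bullet> n x = 0" "pdv ?g x \<bullet> n x = 0"
        using n that by (simp_all add: unit_normal_on_def pdu_def pdv_def)
      moreover have "focal_factor x \<noteq> 0"
        using regular_partD[OF x] by (simp add: focal_factor_def)
      ultimately show "norm (n x) = 1" "n x \<bullet> pdu f x = 0" "n x \<bullet> \<nu> x = 0"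
        by (simp_all add: axis_focal_pdu[OF x that(2)] axis_focal_pdv[OF x that(2)] inner_commute)
    qed
    let ?k = "\<lambda>x. n x \<bullet> cross3 (\<nu> x) (pdu f x)" and ?A = "W \<inter> {x. x$2 = 0}"
    have WU: "W \<subseteq> U" using W(4) regular_part_subset by blast
    have k2: "(?k x)\<^sup>2 = (norm (pdu f x))\<^sup>2" and k0: "?k x \<noteq> 0" if "x \<in> ?A" for x
    proof -
      have x: "x \<in> regular_part" "x$2 = 0" using that W by auto
      show "(?k x)\<^sup>2 = (norm (pdu f x))\<^sup>2"
        using axis_focal_curvatures(1)[of x n, OF x] normal[of x] that by auto
      moreover have "pdu f x \<noteq> 0"
        using pdu_f_nonzero[of x] regular_partD(1,2)[OF x(1)] by simp
      ultimately show "?k x \<noteq> 0" by auto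
    qed
    have "convex {x::real^2. x$2 = 0}"
      using convex_hyperplane[of "axis 2 1 :: real^2" 0] by (simp add: inner_axis')
    then have conn: "connected ?A"
      by (intro convex_connected convex_Int W)
    have "smooth_on W ?k"
      using n unfolding unit_normal_on_def
      by (intro smooth_on_inner smooth_on_cross3 smooth_on_subset[OF smooth_\<nu> WU]
          smooth_on_subset[OF smooth_partials(1) WU] W(1)) auto
    then have cont: "continuous_on ?A ?k"
      using smooth_on_imp_continuous_on continuous_on_subset by blast
    define \<sigma> where "\<sigma> = - sgn (?k 0)"
    have \<sigma>: "\<sigma> \<in> {1, -1}"
      using k0[of 0] W(3) by (auto simp: \<sigma>_def sgn_if)
    have ratio: "- (?k x / norm (pdu f x)) = \<sigma>" if x: "x \<in> ?A" for x
    proof -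
      have "sgn (?k x) = sgn (?k 0)"
        using connected_nonzero_same_sign[OF conn cont _ x, of 0] k0 W(3) by auto
      moreover have "\<bar>?k x\<bar> = norm (pdu f x)"
        using k2[OF x] by (metis real_sqrt_abs abs_norm_cancel)
      moreover have "?k x / \<bar>?k x\<bar> = sgn (?k x)"
        using k0[OF x] by (simp add: sgn_if)
      ultimately show ?thesis by (simp add: \<sigma>_def)
    qed
    have "mean_curvature ?g n x =
          \<sigma> * (1/8) * ((cuspidal_curvature f x)\<^sup>2 - 4 * singular_curvature f \<nu> x)"
      if "x \<in> W" "x$2 = 0" for x
      using axis_focal_curvatures(3)[of x n, OF _ that(2) normal[OF that]] ratio[of x] that W(4) by auto
    moreover have "gauss_curvature ?g n x =
          - (1/4) * (4 * (cusp_directional_torsion f x)\<^sup>2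
                     + singular_curvature f \<nu> x * (cuspidal_curvature f x)\<^sup>2)" if "x \<in> W" "x$2 = 0" for x
      using axis_focal_curvatures(2)[of x n, OF _ that(2) normal[OF that]] that W(4) by auto
    ultimately show ?thesis using \<sigma> by blast
  qed
  have "connected W" using W(2) convex_connected by blast
  moreover have "W \<subseteq> U" using W(4) regular_part_subset by blast
  ultimately show ?thesis using W(1,3,5) curvatures by blast
qed

end

section \<open>Passage to adapted coordinates\<close>

lemma diffeomorphism_inj_derivative:
  assumes "diffeomorphism U V \<phi> \<psi>" "x \<in> U"
  shows "inj (frechet_derivative \<phi> (at x))"
proof -
  have U: "open U" and \<phi>: "smooth_on U \<phi>" and \<psi>: "smooth_on V \<psi>" and hom: "homeomorphism U V \<phi> \<psi>"
    using assms(1) by (auto simp: diffeomorphism_def)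
  have "\<phi> x \<in> V" using hom assms(2) by (auto simp: homeomorphism_def)
  have "((\<lambda>y. \<psi> (\<phi> y)) has_derivative
      (\<lambda>X. frechet_derivative \<psi> (at (\<phi> x)) (frechet_derivative \<phi> (at x) X))) (at x)"
    using has_derivative_compose smooth_on_has_derivative[OF \<phi> assms(2)]
      smooth_on_has_derivative[OF \<psi> \<open>\<phi> x \<in> V\<close>] by blast
  moreover have "\<psi> (\<phi> y) = y" if "y \<in> U" for y
    using hom that by (simp add: homeomorphism_def)
  ultimately have "((\<lambda>y. y) has_derivative
      (\<lambda>X. frechet_derivative \<psi> (at (\<phi> x)) (frechet_derivative \<phi> (at x) X))) (at x)"
    by (rule has_derivative_transform_within_open[OF _ U assms(2)])
  then have "(\<lambda>X. frechet_derivative \<psi> (at (\<phi> x)) (frechet_derivative \<phi> (at x) X)) = (\<lambda>X. X)"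
    using has_derivative_unique has_derivative_ident by blast
  then show ?thesis
    by (metis injI)
qed

text \<open>The only assumption of \<open>adapted_front\<close> that does not follow at once from the chain rule is that
  \<open>pdv (\<nu> \<circ> \<phi>)\<close> does not vanish on the axis: otherwise the differential of \<open>(f, \<nu>)\<close> would annihilate
  the image of the vertical direction under the invertible differential of \<open>\<phi>\<close>.\<close>

lemma adapted_frontI:
  assumes "open \<Sigma>" and front: "front_with_normal \<Sigma> f \<nu>"
    and adapted: "adapted_coordinates \<Sigma> f \<nu> p U \<phi>" and factor: "singular_factor U (f \<circ> \<phi>) h"
  shows "adapted_front U (f \<circ> \<phi>) (\<nu> \<circ> \<phi>) h"
proof -
  obtain V \<psi> where diff: "diffeomorphism U V \<phi> \<psi>" and "V \<subseteq> \<Sigma>"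
    using adapted by (auto simp: adapted_coordinates_def)
  have U: "open U" and \<phi>: "smooth_on U \<phi>" and "\<phi> ` U \<subseteq> \<Sigma>"
    using diff \<open>V \<subseteq> \<Sigma>\<close> by (auto simp: diffeomorphism_def homeomorphism_def)
  have f: "smooth_on \<Sigma> f" and \<nu>: "smooth_on \<Sigma> \<nu>"
    and normal: "\<And>q. q \<in> \<Sigma> \<Longrightarrow> norm (\<nu> q) = 1" "\<And>q X. q \<in> \<Sigma> \<Longrightarrow> frechet_derivative f (at q) X \<bullet> \<nu> q = 0"
    and imm: "\<And>q. q \<in> \<Sigma> \<Longrightarrow> inj (frechet_derivative (\<lambda>q. (f q, \<nu> q)) (at q))"
    using front by (auto simp: front_with_normal_def unit_normal_on_def immersion_on_def)
  have chain: "frechet_derivative (F \<circ> \<phi>) (at x) X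
      = frechet_derivative F (at (\<phi> x)) (frechet_derivative \<phi> (at x) X)"
    if "smooth_on \<Sigma> F" "x \<in> U" for F :: "real^2 \<Rightarrow> real^3" and x X
    using frechet_derivative_compose[of \<phi> x F] smooth_on_differentiable[OF \<phi> that(2)]
      smooth_on_differentiable[OF that(1), of "\<phi> x"] \<open>\<phi> ` U \<subseteq> \<Sigma>\<close> that(2) by auto
  have pdv_nz: "pdv (\<nu> \<circ> \<phi>) x \<noteq> 0" if x: "x \<in> U" "x$2 = 0" for x
  proof
    assume \<nu>0: "pdv (\<nu> \<circ> \<phi>) x = 0"
    have f0: "pdv (f \<circ> \<phi>) x = 0"
      using adapted x by (simp add: adapted_coordinates_def)
    let ?X = "frechet_derivative \<phi> (at x) (axis 2 1)" and ?q = "\<phi> x"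
    have q: "?q \<in> \<Sigma>" using x \<open>\<phi> ` U \<subseteq> \<Sigma>\<close> by auto
    have D: "((\<lambda>q. (f q, \<nu> q)) has_derivative
        (\<lambda>X. (frechet_derivative f (at ?q) X, frechet_derivative \<nu> (at ?q) X))) (at ?q)"
      by (rule has_derivative_Pair[OF smooth_on_has_derivative[OF f q] smooth_on_has_derivative[OF \<nu> q]])
    have "frechet_derivative f (at ?q) ?X = 0" "frechet_derivative \<nu> (at ?q) ?X = 0"
      using f0 \<nu>0 chain[OF f x(1)] chain[OF \<nu> x(1)] by (simp_all add: pdv_def)
    then have "frechet_derivative (\<lambda>q. (f q, \<nu> q)) (at ?q) ?X = 0"
      by (simp add: frechet_derivative_at[OF D, symmetric] zero_prod_def)
    moreover have "linear (frechet_derivative (\<lambda>q. (f q, \<nu> q)) (at ?q))"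
      using D by (intro linear_frechet_derivative) (auto simp: differentiable_def)
    ultimately have "?X = 0"
      using imm[OF q] linear_injective_0 by blast
    moreover have "linear (frechet_derivative \<phi> (at x))"
      by (rule linear_frechet_derivative[OF smooth_on_differentiable[OF \<phi> x(1)]])
    ultimately have "axis 2 1 = (0 :: real^2)"
      using diffeomorphism_inj_derivative[OF diff x(1)] linear_injective_0 by blast
    then show False by (simp add: axis_eq_0_iff)
  qed
  show ?thesis
  proof
    show "open U" by (rule U)
    show "smooth_on U (f \<circ> \<phi>)" "smooth_on U (\<nu> \<circ> \<phi>)"
      using smooth_on_compose[OF U assms(1) \<open>\<phi> ` U \<subseteq> \<Sigma>\<close> _ \<phi>] f \<nu> by (simp_all add: o_def)
    show "smooth_on U h" using factor by (simp add: singular_factor_def)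
    fix x assume x: "x \<in> U"
    then have q: "\<phi> x \<in> \<Sigma>" using \<open>\<phi> ` U \<subseteq> \<Sigma>\<close> by auto
    show "norm ((\<nu> \<circ> \<phi>) x) = 1" using normal(1)[OF q] by simp
    show "pdu (f \<circ> \<phi>) x \<bullet> (\<nu> \<circ> \<phi>) x = 0" "pdv (f \<circ> \<phi>) x \<bullet> (\<nu> \<circ> \<phi>) x = 0"
      using normal(2)[OF q] chain[OF f x] by (simp_all add: pdu_def pdv_def)
    show "pdv (f \<circ> \<phi>) x = x$2 *\<^sub>R h x"
      using factor x by (simp add: singular_factor_def)
    show "pdv (area_density (f \<circ> \<phi>) (\<nu> \<circ> \<phi>)) x > 0" if "x$2 = 0"
      using adapted x that by (simp add: adapted_coordinates_def)
    show "pdv (\<nu> \<circ> \<phi>) x \<noteq> 0" if "x$2 = 0"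
      using pdv_nz x that by blast
  qed
qed

theorem theorem3p8:
  fixes \<Sigma> U :: "(real^2) set" and f \<nu> h :: "real^2 \<Rightarrow> real^3"
    and \<phi> :: "real^2 \<Rightarrow> real^2" and p :: "real^2"
  defines "ff \<equiv> f \<circ> \<phi>" and "\<nu>\<nu> \<equiv> \<nu> \<circ> \<phi>"
  defines "FC \<equiv> focal_surface ff \<nu>\<nu> h"
  assumes "open \<Sigma>" and "connected \<Sigma>"
    and "front_with_normal \<Sigma> f \<nu>"
    and "p \<in> \<Sigma>" and "cuspidal_edge \<Sigma> f p"
    and "adapted_coordinates \<Sigma> f \<nu> p U \<phi>"
    and "singular_factor U ff h"
  shows "\<exists>W. open W \<and> connected W \<and> 0 \<in> W \<and> W \<subseteq> U \<and> immersion_on W FC \<and>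
    (\<forall>n. unit_normal_on W FC n \<longrightarrow>
      (\<forall>x\<in>W. x$2 = 0 \<longrightarrow>
        gauss_curvature FC n x =
          - (1/4) * (4 * (cusp_directional_torsion ff x)\<^sup>2
                     + singular_curvature ff \<nu>\<nu> x * (cuspidal_curvature ff x)\<^sup>2)) \<and>
      (\<exists>\<sigma>\<in>{1, -1}. \<forall>x\<in>W. x$2 = 0 \<longrightarrow>
        mean_curvature FC n x =
          \<sigma> * (1/8) * ((cuspidal_curvature ff x)\<^sup>2 - 4 * singular_curvature ff \<nu>\<nu> x)))"
proof -
  have "adapted_front U ff \<nu>\<nu> h"
    using adapted_frontI assms unfolding ff_def \<nu>\<nu>_def by blast
  moreover have "0 \<in> U"
    using assms(9) by (simp add: adapted_coordinates_def)
  ultimately show ?thesis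
    unfolding FC_def by (rule adapted_front.focal_surface_curvatures)
qed

end
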